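(* Let $K$ be a field belonging to at least one of the following classes: (1) finitely generated fields; (2) real closed fields; (3) $p$-adically closed fields ($p$ a prime); (4) algebraically closed fields. Then the field $K$ is not bi-interpretable (without parameters) with the group $H(K)$.
   Context: For a field $K$, the Heisenberg group $H(K)=\mathrm{UT}_3(K)$ is the group, under matrix multiplication, of upper unitriangular $3\times 3$ matrices with coefficients in $K$. Fields are structures in the language of rings, groups are structures in the pure language of groups. "Finitely generated" means finitely generated as a field (i.e. over the prime field). A $p$-adically closed field means a field elementarily equivalent to $\mathbb{Q}_p$. Two structures $\mathcal M$ and $\mathcal N$ are bi-interpretable (without parameters) if there are parameter-free interpretations $\Gamma$ of $\mathcal N$ in $\mathcal M$ and $\Delta$ of $\mathcal M$ in $\mathcal N$ (in the usual model-theoretic sense, on definable quotients of finite Cartesian powers) such that the natural isomorphism between $\mathcal M$ and the copy of $\mathcal M$ interpreted in $\mathcal M$ by the composite is $\emptyset$-definable in $\mathcal M$, and the natural isomorphism between $\mathcal N$ and the copy of $\mathcal N$ interpreted in $\mathcal N$ by the composite is $\emptyset$-definable in $\mathcal N$. *)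

theory Defs
  imports
    "HOL-Algebra.Algebra"
    "HOL-Analysis.Finite_Cartesian_Product"
begin

section \<open>First-order logic\<close>

text \<open>Only languages without relation symbols other than equality are needed. A language is a type
  of function symbols (constants being symbols of arity 0) of class \<open>signature\<close>.\<close>

class signature =
  fixes arity :: "'a \<Rightarrow> nat"

datatype 'f tm = Var nat | Fn 'f "'f tm list"

datatype 'f fm = Eq "'f tm" "'f tm" | Neg "'f fm" | Conj "'f fm" "'f fm" | Ex nat "'f fm"

fun wf_tm :: "'f::signature tm \<Rightarrow> bool" where
  "wf_tm (Var x) \<longleftrightarrow> True"
| "wf_tm (Fn f ts) \<longleftrightarrow> length ts = arity f \<and> (\<forall>t\<in>set ts. wf_tm t)"

primrec wf_fm :: "'f::signature fm \<Rightarrow> bool" where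
  "wf_fm (Eq s t) \<longleftrightarrow> wf_tm s \<and> wf_tm t"
| "wf_fm (Neg \<phi>) \<longleftrightarrow> wf_fm \<phi>"
| "wf_fm (Conj \<phi> \<psi>) \<longleftrightarrow> wf_fm \<phi> \<and> wf_fm \<psi>"
| "wf_fm (Ex x \<phi>) \<longleftrightarrow> wf_fm \<phi>"

fun fv_tm :: "'f tm \<Rightarrow> nat set" where
  "fv_tm (Var x) = {x}"
| "fv_tm (Fn f ts) = (\<Union>t\<in>set ts. fv_tm t)"

primrec fv_fm :: "'f fm \<Rightarrow> nat set" where
  "fv_fm (Eq s t) = fv_tm s \<union> fv_tm t"
| "fv_fm (Neg \<phi>) = fv_fm \<phi>"
| "fv_fm (Conj \<phi> \<psi>) = fv_fm \<phi> \<union> fv_fm \<psi>"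
| "fv_fm (Ex x \<phi>) = fv_fm \<phi> - {x}"

record ('f, 'a) fo_struct =
  univ :: "'a set"
  fun_interp :: "'f \<Rightarrow> 'a list \<Rightarrow> 'a"

primrec eval_tm :: "('f, 'a) fo_struct \<Rightarrow> (nat \<Rightarrow> 'a) \<Rightarrow> 'f tm \<Rightarrow> 'a" where
  "eval_tm M e (Var x) = e x"
| "eval_tm M e (Fn f ts) = fun_interp M f (map (eval_tm M e) ts)"

primrec sat :: "('f, 'a) fo_struct \<Rightarrow> (nat \<Rightarrow> 'a) \<Rightarrow> 'f fm \<Rightarrow> bool" where
  "sat M e (Eq s t) \<longleftrightarrow> eval_tm M e s = eval_tm M e t"
| "sat M e (Neg \<phi>) \<longleftrightarrow> \<not> sat M e \<phi>"
| "sat M e (Conj \<phi> \<psi>) \<longleftrightarrow> sat M e \<phi> \<and> sat M e \<psi>"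
| "sat M e (Ex x \<phi>) \<longleftrightarrow> (\<exists>a\<in>univ M. sat M (e(x := a)) \<phi>)"

definition models :: "('f, 'a) fo_struct \<Rightarrow> 'f fm \<Rightarrow> bool" where
  "models M \<phi> \<longleftrightarrow> (\<forall>e. range e \<subseteq> univ M \<longrightarrow> sat M e \<phi>)"

definition elementarily_equivalent ::
  "('f::signature, 'a) fo_struct \<Rightarrow> ('f, 'b) fo_struct \<Rightarrow> bool" where
  "elementarily_equivalent M N \<longleftrightarrow>
     (\<forall>\<phi>. wf_fm \<phi> \<and> fv_fm \<phi> = {} \<longrightarrow> (models M \<phi> \<longleftrightarrow> models N \<phi>))"

text \<open>Definability without parameters. The \<open>i\<close>-th entry of a tuple is the value of the variable
  \<open>i\<close>; the values \<open>xs ! i\<close> for \<open>i \<ge> n\<close> are irrelevant, since such variables are not free.\<close>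

definition definable :: "('f::signature, 'a) fo_struct \<Rightarrow> nat \<Rightarrow> 'a list set \<Rightarrow> bool" where
  "definable M n R \<longleftrightarrow>
     (\<exists>\<phi>. wf_fm \<phi> \<and> fv_fm \<phi> \<subseteq> {..<n} \<and>
        R = {xs. length xs = n \<and> set xs \<subseteq> univ M \<and> sat M (nth xs) \<phi>})"


section \<open>Interpretations and bi-interpretability\<close>

text \<open>An interpretation of \<open>N\<close> in \<open>M\<close> is given by a dimension, a definable set of tuples from \<open>M\<close>,
  and a coordinate map from this set onto \<open>N\<close>. The kernel of the coordinate map is the definable
  equivalence relation, and the coordinate map induces the isomorphism from the quotient (the copy
  of \<open>N\<close> interpreted in \<open>M\<close>) onto \<open>N\<close>.\<close>

record ('a, 'b) interp =
  int_dim :: nat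
  int_dom :: "'a list set"
  coord :: "'a list \<Rightarrow> 'b"

definition interprets ::
  "('f::signature, 'a) fo_struct \<Rightarrow> ('g::signature, 'b) fo_struct \<Rightarrow> ('a, 'b) interp \<Rightarrow> bool" where
  "interprets M N \<Gamma> \<longleftrightarrow>
     definable M (int_dim \<Gamma>) (int_dom \<Gamma>) \<and>
     coord \<Gamma> ` int_dom \<Gamma> = univ N \<and>
     definable M (2 * int_dim \<Gamma>)
       {xs @ ys | xs ys. xs \<in> int_dom \<Gamma> \<and> ys \<in> int_dom \<Gamma> \<and> coord \<Gamma> xs = coord \<Gamma> ys} \<and>
     (\<forall>g. definable M (Suc (arity g) * int_dim \<Gamma>)
       {concat xss @ ys | xss ys.
          length xss = arity g \<and> set xss \<subseteq> int_dom \<Gamma> \<and> ys \<in> int_dom \<Gamma> \<and>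
          fun_interp N g (map (coord \<Gamma>) xss) = coord \<Gamma> ys})"

text \<open>\<open>blocks n m zs\<close> cuts a tuple of length \<open>m * n\<close> into \<open>m\<close> consecutive tuples of length \<open>n\<close>.\<close>

definition blocks :: "nat \<Rightarrow> nat \<Rightarrow> 'a list \<Rightarrow> 'a list list" where
  "blocks n m zs = map (\<lambda>i. take n (drop (i * n) zs)) [0..<m]"

text \<open>If \<open>\<Gamma>\<close> interprets \<open>N\<close> in \<open>M\<close> and \<open>\<Delta>\<close> interprets \<open>P\<close> in \<open>N\<close>, then \<open>comp_interp \<Gamma> \<Delta>\<close> is the
  composite interpretation of \<open>P\<close> in \<open>M\<close>.\<close>

definition comp_interp :: "('a, 'b) interp \<Rightarrow> ('b, 'c) interp \<Rightarrow> ('a, 'c) interp" where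
  "comp_interp \<Gamma> \<Delta> =
     (let cut = blocks (int_dim \<Gamma>) (int_dim \<Delta>) in
      \<lparr> int_dim = int_dim \<Delta> * int_dim \<Gamma>,
        int_dom = {zs. length zs = int_dim \<Delta> * int_dim \<Gamma> \<and> set (cut zs) \<subseteq> int_dom \<Gamma> \<and>
                       map (coord \<Gamma>) (cut zs) \<in> int_dom \<Delta>},
        coord = (\<lambda>zs. coord \<Delta> (map (coord \<Gamma>) (cut zs))) \<rparr>)"

text \<open>For an interpretation of \<open>M\<close> in itself: the isomorphism between \<open>M\<close> and the interpreted copy
  of \<open>M\<close> is definable, i.e. its graph, pulled back to tuples representing elements of the copy,
  is a definable relation.\<close>

definition definable_iso :: "('f::signature, 'a) fo_struct \<Rightarrow> ('a, 'a) interp \<Rightarrow> bool" where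
  "definable_iso M \<Gamma> \<longleftrightarrow> definable M (Suc (int_dim \<Gamma>)) {coord \<Gamma> zs # zs | zs. zs \<in> int_dom \<Gamma>}"

definition bi_interpretable ::
  "('f::signature, 'a) fo_struct \<Rightarrow> ('g::signature, 'b) fo_struct \<Rightarrow> bool" where
  "bi_interpretable M N \<longleftrightarrow>
     (\<exists>\<Gamma> \<Delta>. interprets M N \<Gamma> \<and> interprets N M \<Delta> \<and>
        definable_iso M (comp_interp \<Gamma> \<Delta>) \<and> definable_iso N (comp_interp \<Delta> \<Gamma>))"


section \<open>Rings and groups as first-order structures\<close>

datatype ring_sym = RZero | ROne | RNeg | RAdd | RMult

instantiation ring_sym :: signature
begin
primrec arity_ring_sym :: "ring_sym \<Rightarrow> nat" where
  "arity RZero = 0" | "arity ROne = 0" | "arity RNeg = 1" | "arity RAdd = 2" | "arity RMult = 2"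
instance ..
end

datatype group_sym = GOne | GInv | GMult

instantiation group_sym :: signature
begin
primrec arity_group_sym :: "group_sym \<Rightarrow> nat" where
  "arity GOne = 0" | "arity GInv = 1" | "arity GMult = 2"
instance ..
end

definition ring_structure :: "('a, 'm) ring_scheme \<Rightarrow> (ring_sym, 'a) fo_struct" where
  "ring_structure R =
     \<lparr> univ = carrier R,
       fun_interp = (\<lambda>f xs. case f of
           RZero \<Rightarrow> \<zero>\<^bsub>R\<^esub>
         | ROne \<Rightarrow> \<one>\<^bsub>R\<^esub>
         | RNeg \<Rightarrow> \<ominus>\<^bsub>R\<^esub> (xs ! 0)
         | RAdd \<Rightarrow> xs ! 0 \<oplus>\<^bsub>R\<^esub> xs ! 1
         | RMult \<Rightarrow> xs ! 0 \<otimes>\<^bsub>R\<^esub> xs ! 1) \<rparr>"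

definition group_structure :: "('a, 'm) monoid_scheme \<Rightarrow> (group_sym, 'a) fo_struct" where
  "group_structure G =
     \<lparr> univ = carrier G,
       fun_interp = (\<lambda>f xs. case f of
           GOne \<Rightarrow> \<one>\<^bsub>G\<^esub>
         | GInv \<Rightarrow> inv\<^bsub>G\<^esub> (xs ! 0)
         | GMult \<Rightarrow> xs ! 0 \<otimes>\<^bsub>G\<^esub> xs ! 1) \<rparr>"


section \<open>The Heisenberg group\<close>

text \<open>The index type \<open>3\<close> has the elements \<open>1\<close>, \<open>2\<close>, \<open>3\<close>; there \<open>3 = 0\<close>, so that its
  built-in order is not the order of the rows and columns, and the entries are listed explicitly.\<close>

definition heisenberg :: "('a, 'm) ring_scheme \<Rightarrow> ('a^3^3) monoid" where
  "heisenberg K =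
     \<lparr> carrier = {A. (\<forall>i j. A $ i $ j \<in> carrier K) \<and>
                     A $ 1 $ 1 = \<one>\<^bsub>K\<^esub> \<and> A $ 2 $ 2 = \<one>\<^bsub>K\<^esub> \<and> A $ 3 $ 3 = \<one>\<^bsub>K\<^esub> \<and>
                     A $ 2 $ 1 = \<zero>\<^bsub>K\<^esub> \<and> A $ 3 $ 1 = \<zero>\<^bsub>K\<^esub> \<and> A $ 3 $ 2 = \<zero>\<^bsub>K\<^esub>},
       monoid.mult = (\<lambda>A B. \<chi> i j. \<Oplus>\<^bsub>K\<^esub>k\<in>UNIV. A $ i $ k \<otimes>\<^bsub>K\<^esub> B $ k $ j),
       one = (\<chi> i j. if i = j then \<one>\<^bsub>K\<^esub> else \<zero>\<^bsub>K\<^esub>) \<rparr>"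


section \<open>The classes of fields\<close>

definition finitely_generated_field :: "('a, 'm) ring_scheme \<Rightarrow> bool" where
  "finitely_generated_field K \<longleftrightarrow>
     field K \<and> (\<exists>S. finite S \<and> S \<subseteq> carrier K \<and> generate_field K S = carrier K)"

definition field_ordering :: "('a, 'm) ring_scheme \<Rightarrow> ('a \<Rightarrow> 'a \<Rightarrow> bool) \<Rightarrow> bool" where
  "field_ordering K leq \<longleftrightarrow>
     (\<forall>x\<in>carrier K. leq x x) \<and>
     (\<forall>x\<in>carrier K. \<forall>y\<in>carrier K. leq x y \<and> leq y x \<longrightarrow> x = y) \<and>
     (\<forall>x\<in>carrier K. \<forall>y\<in>carrier K. \<forall>z\<in>carrier K. leq x y \<and> leq y z \<longrightarrow> leq x z) \<and>
     (\<forall>x\<in>carrier K. \<forall>y\<in>carrier K. leq x y \<or> leq y x) \<and>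
     (\<forall>x\<in>carrier K. \<forall>y\<in>carrier K. \<forall>z\<in>carrier K. leq x y \<longrightarrow> leq (x \<oplus>\<^bsub>K\<^esub> z) (y \<oplus>\<^bsub>K\<^esub> z)) \<and>
     (\<forall>x\<in>carrier K. \<forall>y\<in>carrier K. leq \<zero>\<^bsub>K\<^esub> x \<and> leq \<zero>\<^bsub>K\<^esub> y \<longrightarrow> leq \<zero>\<^bsub>K\<^esub> (x \<otimes>\<^bsub>K\<^esub> y))"

definition real_closed_field :: "('a, 'm) ring_scheme \<Rightarrow> bool" where
  "real_closed_field K \<longleftrightarrow>
     field K \<and>
     (\<exists>leq. field_ordering K leq \<and>
        (\<forall>x\<in>carrier K. leq \<zero>\<^bsub>K\<^esub> x \<longrightarrow> (\<exists>y\<in>carrier K. y \<otimes>\<^bsub>K\<^esub> y = x))) \<and>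
     (\<forall>P\<in>carrier (poly_ring K). odd (Polynomials.degree P) \<longrightarrow>
        (\<exists>x\<in>carrier K. ring.eval K P x = \<zero>\<^bsub>K\<^esub>))"

text \<open>The field of \<open>p\<close>-adic numbers is the completion of the rationals with respect to the
  \<open>p\<close>-adic absolute value: the ring of Cauchy sequences modulo the ideal of null sequences.\<close>

definition padic_abs :: "nat \<Rightarrow> rat \<Rightarrow> real" where
  "padic_abs p x =
     (if x = 0 then 0
      else real p powi (int (multiplicity (int p) (snd (quotient_of x)))
                        - int (multiplicity (int p) (fst (quotient_of x)))))"

definition padic_Cauchy_ring :: "nat \<Rightarrow> (nat \<Rightarrow> rat) ring" where
  "padic_Cauchy_ring p =
     \<lparr> carrier = {s. \<forall>\<epsilon>>0. \<exists>N. \<forall>m\<ge>N. \<forall>n\<ge>N. padic_abs p (s m - s n) < \<epsilon>},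
       monoid.mult = (\<lambda>s t n. s n * t n),
       one = (\<lambda>n. 1),
       ring.zero = (\<lambda>n. 0),
       ring.add = (\<lambda>s t n. s n + t n) \<rparr>"

definition padic_null_ideal :: "nat \<Rightarrow> (nat \<Rightarrow> rat) set" where
  "padic_null_ideal p = {s. (\<lambda>n. padic_abs p (s n)) \<longlonglongrightarrow> 0}"

definition padic_field :: "nat \<Rightarrow> (nat \<Rightarrow> rat) set ring" where
  "padic_field p = padic_Cauchy_ring p Quot padic_null_ideal p"

definition p_adically_closed_field :: "nat \<Rightarrow> ('a, 'm) ring_scheme \<Rightarrow> bool" where
  "p_adically_closed_field p K \<longleftrightarrow>
     field K \<and> elementarily_equivalent (ring_structure K) (ring_structure (padic_field p))"

end

theory Submission
  imports Defs "HOL-Analysis.Cartesian_Space"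
begin

text \<open>An interpretation of \<open>K\<close> in \<open>H(K)\<close> lets every automorphism of \<open>H(K)\<close> act on \<open>K\<close>, and
  definability of the isomorphism between \<open>H(K)\<close> and its copy inside itself makes this action
  faithful. Moreover a tuple of \<open>K\<close> is fixed as soon as the automorphism fixes a suitable finite
  subset of \<open>H(K)\<close>. So \<open>H(K)\<close> cannot have more automorphisms than \<open>K\<close> has endomorphisms.

  Outside characteristic \<open>2\<close>, \<open>(x, y, z) \<mapsto> (y, -x, z - x y)\<close> is an automorphism of \<open>H(K)\<close> of order
  \<open>4\<close>. A field has no endomorphism \<open>\<phi>\<close> of order \<open>4\<close> if each of its elements has the form \<open>r b\<^sup>2\<close>
  with \<open>r\<close> fixed by all endomorphisms: for \<open>a = x - \<phi>\<^sup>2 x = r b\<^sup>2\<close> the map \<open>\<phi>\<^sup>2\<close> negates \<open>a\<close>, hence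
  multiplies \<open>b\<close> by a square root of \<open>-1\<close>, which \<open>\<phi>\<^sup>2\<close> fixes, so that \<open>\<phi>\<^sup>4 b = -b\<close>. This settles
  algebraically closed (\<open>r = 1\<close>), real closed (\<open>r = \<plusminus>1\<close>) and \<open>p\<close>-adically closed fields (\<open>r\<close> in a
  finite set of integers, a first-order property of the \<open>p\<close>-adic numbers). In an algebraically
  closed field of characteristic \<open>2\<close>, Kummer theory excludes endomorphisms of order \<open>3\<close>, while a
  primitive cube root of unity \<open>c\<close> gives the automorphism \<open>(x, y, z) \<mapsto> (c x, y, c z)\<close>.

  For \<open>K\<close> generated by a finite set \<open>S\<close>, an endomorphism fixing \<open>S\<close> is trivial, so an automorphism
  of \<open>H(K)\<close> fixing a certain finite set is trivial. If \<open>K\<close> has infinite dimension over its prime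
  field, the automorphism \<open>(x, y, z) \<mapsto> (x, y, z + f x)\<close>, where \<open>f\<close> is additive, nonzero and vanishes
  on the relevant finite set, contradicts this. If the dimension is finite, then \<open>K\<close> has finitely
  many endomorphisms, and fewer than \<open>|K|\<close> if \<open>K\<close> is finite; but the additive maps \<open>x \<mapsto> c x\<close> provide
  \<open>|K|\<close> automorphisms of \<open>H(K)\<close>.\<close>


section \<open>Automorphisms and interpretations\<close>

text \<open>The record type does not force the universe to be closed under the function symbols, so
  closure is carried as a separate condition.\<close>

definition fun_closed :: "('f::signature, 'a) fo_struct \<Rightarrow> bool" where
  "fun_closed M \<longleftrightarrow>
     (\<forall>f xs. length xs = arity f \<and> set xs \<subseteq> univ M \<longrightarrow> fun_interp M f xs \<in> univ M)"

text \<open>Homomorphisms of \<open>M\<close> into itself, injective or not. Values outside the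
  universe are arbitrary, so two such maps are only ever compared on the universe.\<close>

definition endos :: "('f::signature, 'a) fo_struct \<Rightarrow> ('a \<Rightarrow> 'a) set" where
  "endos M = {\<beta>. \<beta> ` univ M \<subseteq> univ M \<and>
     (\<forall>f xs. length xs = arity f \<and> set xs \<subseteq> univ M \<longrightarrow>
        \<beta> (fun_interp M f xs) = fun_interp M f (map \<beta> xs))}"

definition autos :: "('f::signature, 'a) fo_struct \<Rightarrow> ('a \<Rightarrow> 'a) set" where
  "autos M = {\<beta> \<in> endos M. bij_betw \<beta> (univ M) (univ M)}"

lemma autos_endos: "\<beta> \<in> autos M \<Longrightarrow> \<beta> \<in> endos M"
  by (simp add: autos_def)

lemma autos_univ: "\<beta> \<in> autos M \<Longrightarrow> x \<in> univ M \<Longrightarrow> \<beta> x \<in> univ M"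
  by (auto simp: autos_def endos_def)

lemma autos_comp:
  assumes "\<beta> \<in> autos M" "\<gamma> \<in> autos M"
  shows "\<beta> \<circ> \<gamma> \<in> autos M"
proof -
  have "\<beta> (\<gamma> (fun_interp M f xs)) = fun_interp M f (map (\<beta> \<circ> \<gamma>) xs)"
    if "length xs = arity f" "set xs \<subseteq> univ M" for f xs
  proof -
    have "length (map \<gamma> xs) = arity f" "set (map \<gamma> xs) \<subseteq> univ M"
      using that autos_univ[OF assms(2)] by auto
    then have "\<beta> (fun_interp M f (map \<gamma> xs)) = fun_interp M f (map \<beta> (map \<gamma> xs))"
      using assms(1) unfolding autos_def endos_def by blast
    moreover have "\<gamma> (fun_interp M f xs) = fun_interp M f (map \<gamma> xs)"
      using assms(2) that unfolding autos_def endos_def by blast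
    ultimately show ?thesis by simp
  qed
  moreover have "bij_betw (\<beta> \<circ> \<gamma>) (univ M) (univ M)"
    using assms by (auto simp: autos_def intro: bij_betw_trans)
  ultimately show ?thesis
    using autos_univ[OF assms(1)] autos_univ[OF assms(2)] by (auto simp: autos_def endos_def)
qed

lemma id_autos: "id \<in> autos M"
  by (simp add: autos_def endos_def)

lemma eval_tm_endo:
  assumes "\<beta> \<in> endos M" "fun_closed M" "wf_tm t"
    and "\<forall>x\<in>fv_tm t. e x \<in> univ M \<and> e' x = \<beta> (e x)"
  shows "eval_tm M e t \<in> univ M \<and> eval_tm M e' t = \<beta> (eval_tm M e t)"
  using assms(3,4)
proof (induction t)
  case (Fn f ts)
  have IH: "eval_tm M e t \<in> univ M \<and> eval_tm M e' t = \<beta> (eval_tm M e t)" if "t \<in> set ts" for t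
    using Fn.IH[OF that] Fn.prems that by auto
  have eq: "map (eval_tm M e') ts = map \<beta> (map (eval_tm M e) ts)"
    using IH by simp
  have len: "length (map (eval_tm M e) ts) = arity f" and sub: "set (map (eval_tm M e) ts) \<subseteq> univ M"
    using Fn.prems IH by auto
  have "fun_interp M f (map (eval_tm M e) ts) \<in> univ M"
    using assms(2) len sub unfolding fun_closed_def by blast
  moreover have "fun_interp M f (map \<beta> (map (eval_tm M e) ts))
      = \<beta> (fun_interp M f (map (eval_tm M e) ts))"
    using assms(1) len sub unfolding endos_def by (metis (mono_tags, lifting) mem_Collect_eq)
  ultimately show ?case
    unfolding eval_tm.simps eq by blast
qed simp

text \<open>Induction on the formula: injectivity handles equations and surjectivity handles
  quantifiers. The assignments are related only at the free variables because \<open>nth xs\<close>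
  is unspecified beyond the length of \<open>xs\<close>.\<close>

lemma sat_auto:
  assumes "\<beta> \<in> autos M" "fun_closed M" "wf_fm \<phi>"
    and "\<forall>x\<in>fv_fm \<phi>. e x \<in> univ M \<and> e' x = \<beta> (e x)"
  shows "sat M e \<phi> \<longleftrightarrow> sat M e' \<phi>"
  using assms(3,4)
proof (induction \<phi> arbitrary: e e')
  case (Eq s t)
  have "eval_tm M e s \<in> univ M \<and> eval_tm M e' s = \<beta> (eval_tm M e s)"
    "eval_tm M e t \<in> univ M \<and> eval_tm M e' t = \<beta> (eval_tm M e t)"
    by (rule eval_tm_endo[OF autos_endos[OF assms(1)] assms(2)]; use Eq in simp)+
  then show ?case
    using assms(1) by (auto simp: autos_def bij_betw_def inj_on_def)
next
  case (Conj \<phi> \<psi>)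
  have "sat M e \<phi> \<longleftrightarrow> sat M e' \<phi>" "sat M e \<psi> \<longleftrightarrow> sat M e' \<psi>"
    using Conj.prems by (auto intro!: Conj.IH)
  then show ?case by simp
next
  case (Ex x \<phi>)
  have step: "sat M (e(x := a)) \<phi> \<longleftrightarrow> sat M (e'(x := \<beta> a)) \<phi>" if "a \<in> univ M" for a
    using Ex.prems that by (intro Ex.IH) auto
  have "\<exists>a\<in>univ M. b = \<beta> a" if "b \<in> univ M" for b
    using assms(1) that by (auto simp: autos_def bij_betw_def)
  then show ?case
    using step autos_univ[OF assms(1)] by (simp, metis)
qed auto

text \<open>The one fact about definability used below: relations defined without parameters are
  invariant under automorphisms.\<close>

lemma definable_auto:
  assumes "\<beta> \<in> autos M" "fun_closed M" "definable M n R" "xs \<in> R"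
  shows "map \<beta> xs \<in> R"
proof -
  obtain \<phi> where \<phi>: "wf_fm \<phi>" "fv_fm \<phi> \<subseteq> {..<n}"
    "R = {xs. length xs = n \<and> set xs \<subseteq> univ M \<and> sat M (nth xs) \<phi>}"
    using assms(3) by (auto simp: definable_def)
  have xs: "length xs = n" "set xs \<subseteq> univ M" "sat M (nth xs) \<phi>"
    using assms(4) \<phi>(3) by auto
  have "xs ! x \<in> univ M \<and> map \<beta> xs ! x = \<beta> (xs ! x)" if "x \<in> fv_fm \<phi>" for x
    using xs that \<phi>(2) by (auto simp: subset_iff)
  then have "sat M (nth (map \<beta> xs)) \<phi>"
    using xs(3) sat_auto[OF assms(1,2) \<phi>(1), of "nth xs" "nth (map \<beta> xs)"] by blast
  then show ?thesis
    using xs autos_univ[OF assms(1)] \<phi>(3) by auto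
qed

lemma definable_length: "definable M n R \<Longrightarrow> xs \<in> R \<Longrightarrow> length xs = n"
  by (auto simp: definable_def)

lemma definable_univ: "definable M n R \<Longrightarrow> xs \<in> R \<Longrightarrow> set xs \<subseteq> univ M"
  by (auto simp: definable_def)

text \<open>The choice of a representing tuple is arbitrary; \<open>induced_coord\<close> shows that
  for automorphisms it does not affect the value.\<close>

definition induced :: "('a, 'b) interp \<Rightarrow> ('a \<Rightarrow> 'a) \<Rightarrow> 'b \<Rightarrow> 'b" where
  "induced \<Delta> \<beta> m = coord \<Delta> (map \<beta> (SOME xs. xs \<in> int_dom \<Delta> \<and> coord \<Delta> xs = m))"

text \<open>Cutting undoes concatenation, so lists of tuples of one fixed length can be recovered
  from their concatenation.\<close>

lemma blocks_concat:
  assumes "\<forall>xs\<in>set xss. length xs = n" "length xss = m"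
  shows "blocks n m (concat xss) = xss"
proof (rule nth_equalityI)
  show "length (blocks n m (concat xss)) = length xss"
    using assms by (simp add: blocks_def)
  have cut: "take n (drop (i * n) (concat xss)) = xss ! i" if "i < length xss" for i
    using assms(1) that
  proof (induction xss arbitrary: i)
    case (Cons ys yss)
    show ?case
    proof (cases i)
      case 0
      then show ?thesis using Cons.prems by simp
    next
      case (Suc j)
      then show ?thesis
        using Cons.prems Cons.IH[of j] by simp
    qed
  qed simp
  show "blocks n m (concat xss) ! i = xss ! i" if "i < length (blocks n m (concat xss))" for i
    using that assms(2) cut[of i] by (simp add: blocks_def)
qed

lemma map_blocks: "map (map f) (blocks n m zs) = blocks n m (map f zs)"
  by (simp add: blocks_def take_map drop_map)

section \<open>Action of the automorphisms of a structure on a structure interpreted in it\<close>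

locale struct_interp =
  fixes M :: "('f::signature, 'a) fo_struct" and N :: "('g::signature, 'b) fo_struct"
    and \<Delta> :: "('a, 'b) interp"
  assumes closedM: "fun_closed M" and closedN: "fun_closed N" and interp: "interprets M N \<Delta>"
begin

lemma dom_definable: "definable M (int_dim \<Delta>) (int_dom \<Delta>)"
  using interp by (simp add: interprets_def)

lemma coord_onto: "coord \<Delta> ` int_dom \<Delta> = univ N"
  using interp by (simp add: interprets_def)

lemma map_auto_dom: "\<beta> \<in> autos M \<Longrightarrow> xs \<in> int_dom \<Delta> \<Longrightarrow> map \<beta> xs \<in> int_dom \<Delta>"
  using definable_auto[OF _ closedM dom_definable] .

text \<open>The kernel of the coordinate map is definable, hence invariant; since all tuples of the
  domain have the same length, a concatenated pair splits in only one way.\<close>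

lemma map_auto_coord_eq:
  assumes "\<beta> \<in> autos M" "xs \<in> int_dom \<Delta>" "ys \<in> int_dom \<Delta>" "coord \<Delta> xs = coord \<Delta> ys"
  shows "coord \<Delta> (map \<beta> xs) = coord \<Delta> (map \<beta> ys)"
proof -
  let ?R = "{xs @ ys | xs ys. xs \<in> int_dom \<Delta> \<and> ys \<in> int_dom \<Delta> \<and> coord \<Delta> xs = coord \<Delta> ys}"
  have "definable M (2 * int_dim \<Delta>) ?R"
    using interp by (simp add: interprets_def)
  moreover have "xs @ ys \<in> ?R"
    using assms by blast
  ultimately have "map \<beta> (xs @ ys) \<in> ?R"
    using definable_auto[OF assms(1) closedM] by blast
  then obtain us vs where uv: "map \<beta> (xs @ ys) = us @ vs" "us \<in> int_dom \<Delta>" "vs \<in> int_dom \<Delta>"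
    "coord \<Delta> us = coord \<Delta> vs"
    by blast
  have "length us = length (map \<beta> xs)"
    using definable_length[OF dom_definable] assms(2) uv(2) by simp
  then have "us = map \<beta> xs" "vs = map \<beta> ys"
    using uv(1) by auto
  with uv(4) show ?thesis by simp
qed

lemma induced_coord:
  assumes "\<beta> \<in> autos M" "xs \<in> int_dom \<Delta>"
  shows "induced \<Delta> \<beta> (coord \<Delta> xs) = coord \<Delta> (map \<beta> xs)"
proof -
  let ?ys = "SOME ys. ys \<in> int_dom \<Delta> \<and> coord \<Delta> ys = coord \<Delta> xs"
  have "?ys \<in> int_dom \<Delta> \<and> coord \<Delta> ?ys = coord \<Delta> xs"
    by (rule someI[of _ xs]) (simp add: assms(2))
  then show ?thesis
    unfolding induced_def using map_auto_coord_eq[OF assms(1) _ assms(2)] by blast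
qed

lemma univ_coordE:
  assumes "m \<in> univ N"
  obtains xs where "xs \<in> int_dom \<Delta>" "m = coord \<Delta> xs"
  using assms coord_onto by blast

lemma univ_coord_listE:
  assumes "set ms \<subseteq> univ N"
  obtains xss where "set xss \<subseteq> int_dom \<Delta>" "ms = map (coord \<Delta>) xss"
proof -
  have "ms \<in> lists (coord \<Delta> ` int_dom \<Delta>)"
    using assms coord_onto by auto
  then show ?thesis
    using that by (auto simp: lists_image)
qed

text \<open>The graph of each function symbol, pulled back to representing tuples, is definable. An
  automorphism therefore carries a represented instance of the graph to another such
  instance.\<close>

lemma induced_endo:
  assumes \<beta>: "\<beta> \<in> autos M"
  shows "induced \<Delta> \<beta> \<in> endos N"
proof -
  have "induced \<Delta> \<beta> m \<in> univ N" if "m \<in> univ N" for m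
    using that
  proof (rule univ_coordE)
    fix xs assume "xs \<in> int_dom \<Delta>" "m = coord \<Delta> xs"
    then show ?thesis
      using map_auto_dom[OF \<beta>] coord_onto by (auto simp: induced_coord[OF \<beta>])
  qed
  moreover have "induced \<Delta> \<beta> (fun_interp N g ms) = fun_interp N g (map (induced \<Delta> \<beta>) ms)"
    if ms: "length ms = arity g" "set ms \<subseteq> univ N" for g ms
  proof -
    obtain xss where xss: "set xss \<subseteq> int_dom \<Delta>" "ms = map (coord \<Delta>) xss"
      using univ_coord_listE[OF ms(2)] .
    have "fun_interp N g ms \<in> univ N"
      using closedN ms unfolding fun_closed_def by blast
    then obtain ys where ys: "ys \<in> int_dom \<Delta>" "fun_interp N g ms = coord \<Delta> ys"
      by (rule univ_coordE)
    let ?R = "{concat xss @ ys | xss ys.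
          length xss = arity g \<and> set xss \<subseteq> int_dom \<Delta> \<and> ys \<in> int_dom \<Delta> \<and>
          fun_interp N g (map (coord \<Delta>) xss) = coord \<Delta> ys}"
    have "definable M (Suc (arity g) * int_dim \<Delta>) ?R"
      using interp by (simp add: interprets_def)
    moreover have "concat xss @ ys \<in> ?R"
      using xss ys ms(1) by auto
    ultimately have "map \<beta> (concat xss @ ys) \<in> ?R"
      using definable_auto[OF \<beta> closedM] by blast
    then obtain uss vs where uv: "map \<beta> (concat xss @ ys) = concat uss @ vs"
      "length uss = arity g" "set uss \<subseteq> int_dom \<Delta>" "vs \<in> int_dom \<Delta>"
      "fun_interp N g (map (coord \<Delta>) uss) = coord \<Delta> vs"
      by blast
    have "length vs = length (map \<beta> ys)"
      using definable_length[OF dom_definable] ys(1) uv(4) by simp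
    then have vs: "vs = map \<beta> ys" and c: "concat (map (map \<beta>) xss) = concat uss"
      using uv(1) by (auto simp: map_concat)
    have len: "\<forall>us\<in>set uss. length us = int_dim \<Delta>"
      "\<forall>us\<in>set (map (map \<beta>) xss). length us = int_dim \<Delta>"
      using definable_length[OF dom_definable] uv(3) xss(1) by auto
    \<comment> \<open>Equal concatenations of equally many tuples of length
      \<open>int_dim \<Delta>\<close> have equal blocks.\<close>
    have "uss = map (map \<beta>) xss"
    proof -
      have "length (map (map \<beta>) xss) = arity g"
        using ms(1) xss(2) by simp
      then show ?thesis
        using blocks_concat[OF len(1) uv(2)] blocks_concat[OF len(2)] c by metis
    qed
    then have "fun_interp N g (map (coord \<Delta>) (map (map \<beta>) xss)) = coord \<Delta> (map \<beta> ys)"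
      using uv(5) vs by simp
    moreover have "map (coord \<Delta>) (map (map \<beta>) xss) = map (induced \<Delta> \<beta>) ms"
      using xss induced_coord[OF \<beta>] by (auto simp: subset_iff)
    ultimately show ?thesis
      using induced_coord[OF \<beta> ys(1)] ys(2) by simp
  qed
  ultimately show ?thesis
    by (auto simp: endos_def)
qed

lemma induced_comp:
  assumes "\<beta> \<in> autos M" "\<gamma> \<in> autos M" "m \<in> univ N"
  shows "induced \<Delta> (\<beta> \<circ> \<gamma>) m = induced \<Delta> \<beta> (induced \<Delta> \<gamma> m)"
proof -
  obtain xs where "xs \<in> int_dom \<Delta>" "m = coord \<Delta> xs"
    using univ_coordE[OF assms(3)] .
  then show ?thesis
    using induced_coord[OF assms(1)] induced_coord[OF assms(2)] induced_coord[OF autos_comp[OF assms(1,2)]]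
      map_auto_dom[OF assms(2)] by simp
qed

lemma induced_id: "m \<in> univ N \<Longrightarrow> induced \<Delta> id m = m"
  by (erule univ_coordE) (simp add: induced_coord[OF id_autos])

lemma induced_cong:
  assumes "\<beta> \<in> autos M" "\<gamma> \<in> autos M" "\<And>x. x \<in> univ M \<Longrightarrow> \<beta> x = \<gamma> x" "m \<in> univ N"
  shows "induced \<Delta> \<beta> m = induced \<Delta> \<gamma> m"
proof -
  obtain xs where xs: "xs \<in> int_dom \<Delta>" "m = coord \<Delta> xs"
    using univ_coordE[OF assms(4)] .
  then have "map \<beta> xs = map \<gamma> xs"
    using assms(3) definable_univ[OF dom_definable xs(1)] by auto
  then show ?thesis
    unfolding xs(2) induced_coord[OF assms(1) xs(1)] induced_coord[OF assms(2) xs(1)] by (rule arg_cong)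
qed

text \<open>\<open>T\<close> collects the entries of one representing tuple for each element of
  \<open>S\<close>; fixing these entries fixes the tuples and so the elements they
  represent.\<close>

lemma induced_fixes:
  assumes "finite S" "S \<subseteq> univ N"
  obtains T where "finite T" "T \<subseteq> univ M"
    "\<And>\<beta>. \<beta> \<in> autos M \<Longrightarrow> \<forall>t\<in>T. \<beta> t = t \<Longrightarrow> \<forall>s\<in>S. induced \<Delta> \<beta> s = s"
proof -
  have "\<forall>s\<in>S. \<exists>xs. xs \<in> int_dom \<Delta> \<and> coord \<Delta> xs = s"
    using assms(2) coord_onto by (metis image_iff subsetD)
  then obtain r where r: "\<forall>s\<in>S. r s \<in> int_dom \<Delta> \<and> coord \<Delta> (r s) = s"
    by metis
  show thesis
  proof (rule that)
    show "finite (\<Union>s\<in>S. set (r s))"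
      using assms(1) by simp
    show "(\<Union>s\<in>S. set (r s)) \<subseteq> univ M"
      using r definable_univ[OF dom_definable] by blast
    fix \<beta> assume \<beta>: "\<beta> \<in> autos M" and fix_T: "\<forall>t\<in>\<Union>s\<in>S. set (r s). \<beta> t = t"
    have "induced \<Delta> \<beta> s = s" if "s \<in> S" for s
    proof -
      have "map \<beta> (r s) = r s"
        using fix_T that by (auto intro: map_idI)
      then show ?thesis
        using induced_coord[OF \<beta>, of "r s"] r that by auto
    qed
    then show "\<forall>s\<in>S. induced \<Delta> \<beta> s = s" by blast
  qed
qed

text \<open>An automorphism preserves the graph of the isomorphism between \<open>M\<close> and its interpreted copy,
  and its action on the copy only depends on the induced endomorphism of \<open>N\<close>.\<close>

lemma induced_inj:
  assumes \<Gamma>: "interprets N M \<Gamma>" and iso: "definable_iso M (comp_interp \<Delta> \<Gamma>)"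
    and \<beta>: "\<beta> \<in> autos M" and \<gamma>: "\<gamma> \<in> autos M"
    and eq: "\<And>m. m \<in> univ N \<Longrightarrow> induced \<Delta> \<beta> m = induced \<Delta> \<gamma> m"
    and h: "h \<in> univ M"
  shows "\<beta> h = \<gamma> h"
proof -
  define cut where "cut = (blocks (int_dim \<Delta>) (int_dim \<Gamma>) :: 'a list \<Rightarrow> 'a list list)"
  define k where "k = int_dim \<Gamma> * int_dim \<Delta>"
  define D where "D = {zs. length zs = k \<and> set (cut zs) \<subseteq> int_dom \<Delta> \<and>
                       map (coord \<Delta>) (cut zs) \<in> int_dom \<Gamma>}"
  define R where "R = {coord \<Gamma> (map (coord \<Delta>) (cut zs)) # zs | zs. zs \<in> D}"
  have R: "definable M (Suc k) R"
    using iso by (simp add: definable_iso_def comp_interp_def Let_def R_def D_def k_def cut_def)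
  have \<Gamma>_dom: "definable N (int_dim \<Gamma>) (int_dom \<Gamma>)" and \<Gamma>_onto: "coord \<Gamma> ` int_dom \<Gamma> = univ M"
    using \<Gamma> by (simp_all add: interprets_def)
  \<comment> \<open>The element \<open>h\<close> is represented by the tuple \<open>ms\<close> over
    \<open>N\<close>, and each entry of \<open>ms\<close> by a tuple over \<open>M\<close>;
    concatenated, these tuples represent \<open>h\<close> in the composite interpretation.\<close>
  obtain ms where ms: "ms \<in> int_dom \<Gamma>" "h = coord \<Gamma> ms"
    using h \<Gamma>_onto by blast
  obtain xss where xss: "set xss \<subseteq> int_dom \<Delta>" "ms = map (coord \<Delta>) xss"
    using univ_coord_listE[OF definable_univ[OF \<Gamma>_dom ms(1)]] .
  have lens: "\<forall>xs\<in>set xss. length xs = int_dim \<Delta>"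
    using definable_length[OF dom_definable] xss(1) by blast
  moreover have len: "length xss = int_dim \<Gamma>"
    using definable_length[OF \<Gamma>_dom ms(1)] xss(2) by simp
  ultimately have cut: "cut (concat xss) = xss"
    by (simp add: cut_def blocks_concat)
  have "length (concat xss) = (\<Sum>xs\<leftarrow>xss. int_dim \<Delta>)"
    using lens by (simp add: length_concat cong: map_cong)
  then have "length (concat xss) = k"
    by (simp add: sum_list_triv len k_def)
  then have "concat xss \<in> D"
    using xss ms(1) by (simp add: D_def cut)
  then have "h # concat xss \<in> R"
    unfolding R_def by (intro CollectI exI[of _ "concat xss"]) (simp add: cut ms(2) xss(2))
  then have img: "\<delta> h = coord \<Gamma> (map (induced \<Delta> \<delta>) ms)" if \<delta>: "\<delta> \<in> autos M" for \<delta>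
  proof -
    have "map \<delta> (h # concat xss) \<in> R"
      using definable_auto[OF \<delta> closedM R] \<open>h # concat xss \<in> R\<close> by blast
    then have "\<delta> h = coord \<Gamma> (map (coord \<Delta>) (cut (map \<delta> (concat xss))))"
      by (auto simp: R_def)
    also have "cut (map \<delta> (concat xss)) = map (map \<delta>) xss"
      using cut by (simp add: cut_def flip: map_blocks)
    also have "map (coord \<Delta>) (map (map \<delta>) xss) = map (induced \<Delta> \<delta>) ms"
      using xss induced_coord[OF \<delta>] by (auto simp: subset_iff)
    finally show ?thesis .
  qed
  have "map (induced \<Delta> \<beta>) ms = map (induced \<Delta> \<gamma>) ms"
    using eq definable_univ[OF \<Gamma>_dom ms(1)] by (auto simp: subset_iff)
  then show ?thesis
    unfolding img[OF \<beta>] img[OF \<gamma>] by (rule arg_cong)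
qed

end


section \<open>Rings and groups as structures\<close>

lemma fun_closed_ring_structure:
  assumes "ring R"
  shows "fun_closed (ring_structure R)"
proof -
  interpret ring R by fact
  show ?thesis
    unfolding fun_closed_def
  proof (intro allI impI)
    fix f :: ring_sym and xs :: "'a list"
    assume "length xs = arity f \<and> set xs \<subseteq> univ (ring_structure R)"
    then show "fun_interp (ring_structure R) f xs \<in> univ (ring_structure R)"
      by (cases f) (auto simp: ring_structure_def subset_iff numeral_2_eq_2)
  qed
qed

lemma fun_closed_group_structure:
  assumes "group G"
  shows "fun_closed (group_structure G)"
proof -
  interpret group G by fact
  show ?thesis
    unfolding fun_closed_def
  proof (intro allI impI)
    fix f :: group_sym and xs :: "'a list"
    assume "length xs = arity f \<and> set xs \<subseteq> univ (group_structure G)"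
    then show "fun_interp (group_structure G) f xs \<in> univ (group_structure G)"
      by (cases f) (auto simp: group_structure_def subset_iff numeral_2_eq_2)
  qed
qed

lemma endos_ring_structure:
  assumes "\<sigma> \<in> endos (ring_structure R)"
  shows "\<sigma> \<in> ring_hom R R"
proof -
  have app: "\<sigma> (fun_interp (ring_structure R) f xs) = fun_interp (ring_structure R) f (map \<sigma> xs)"
    if "length xs = arity f" "set xs \<subseteq> carrier R" for f xs
    using assms that by (simp add: endos_def ring_structure_def)
  show ?thesis
  proof (rule ring_hom_memI)
    show "\<sigma> x \<in> carrier R" if "x \<in> carrier R" for x
      using assms that by (auto simp: endos_def ring_structure_def)
    show "\<sigma> (x \<otimes>\<^bsub>R\<^esub> y) = \<sigma> x \<otimes>\<^bsub>R\<^esub> \<sigma> y" if "x \<in> carrier R" "y \<in> carrier R" for x y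
      using app[of "[x, y]" RMult] that by (simp add: ring_structure_def)
    show "\<sigma> (x \<oplus>\<^bsub>R\<^esub> y) = \<sigma> x \<oplus>\<^bsub>R\<^esub> \<sigma> y" if "x \<in> carrier R" "y \<in> carrier R" for x y
      using app[of "[x, y]" RAdd] that by (simp add: ring_structure_def)
    show "\<sigma> \<one>\<^bsub>R\<^esub> = \<one>\<^bsub>R\<^esub>"
      using app[of "[]" ROne] by (simp add: ring_structure_def)
  qed
qed

lemma autos_group_structure:
  assumes "group G" "\<beta> \<in> hom G G" "bij_betw \<beta> (carrier G) (carrier G)"
  shows "\<beta> \<in> autos (group_structure G)"
proof -
  interpret group_hom G G \<beta>
    using assms by (simp add: group_hom_def group_hom_axioms_def)
  have "\<beta> (fun_interp (group_structure G) f xs) = fun_interp (group_structure G) f (map \<beta> xs)"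
    if "length xs = arity f" "set xs \<subseteq> carrier G" for f xs
    using that by (cases f) (auto simp: group_structure_def subset_iff numeral_2_eq_2)
  then show ?thesis
    using assms(3) by (auto simp: autos_def endos_def group_structure_def)
qed


section \<open>Automorphisms of the Heisenberg group\<close>

definition hmat :: "('a, 'm) ring_scheme \<Rightarrow> 'a \<times> 'a \<times> 'a \<Rightarrow> 'a^3^3" where
  "hmat K = (\<lambda>(x, y, z). \<chi> i j.
     if i = j then \<one>\<^bsub>K\<^esub> else if i = 1 \<and> j = 2 then x else if i = 2 \<and> j = 3 then y
     else if i = 1 \<and> j = 3 then z else \<zero>\<^bsub>K\<^esub>)"

definition hcoords :: "'a^3^3 \<Rightarrow> 'a \<times> 'a \<times> 'a" where
  "hcoords A = (A $ 1 $ 2, A $ 2 $ 3, A $ 1 $ 3)"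

definition triples :: "('a, 'm) ring_scheme \<Rightarrow> ('a \<times> 'a \<times> 'a) set" where
  "triples K = carrier K \<times> carrier K \<times> carrier K"

text \<open>Matrix multiplication in terms of the three entries above the diagonal, the corner entry
  coming last.\<close>

definition hmult :: "('a, 'm) ring_scheme \<Rightarrow> 'a \<times> 'a \<times> 'a \<Rightarrow> 'a \<times> 'a \<times> 'a \<Rightarrow> 'a \<times> 'a \<times> 'a" where
  "hmult K = (\<lambda>(x, y, z) (x', y', z').
     (x \<oplus>\<^bsub>K\<^esub> x', y \<oplus>\<^bsub>K\<^esub> y', z \<oplus>\<^bsub>K\<^esub> z' \<oplus>\<^bsub>K\<^esub> x \<otimes>\<^bsub>K\<^esub> y'))"

lemma hcoords_hmat: "hcoords (hmat K t) = t"
  by (cases t) (simp add: hcoords_def hmat_def)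

lemma hmat_hcoords: "A \<in> carrier (heisenberg K) \<Longrightarrow> hmat K (hcoords A) = A"
  by (simp add: vec_eq_iff forall_3 hcoords_def hmat_def heisenberg_def)

lemma hcoords_carrier: "A \<in> carrier (heisenberg K) \<Longrightarrow> hcoords A \<in> triples K"
  by (simp add: hcoords_def heisenberg_def triples_def)

lemma (in ring) hmat_carrier: "t \<in> triples R \<Longrightarrow> hmat R t \<in> carrier (heisenberg R)"
  by (cases t) (auto simp: forall_3 hmat_def heisenberg_def triples_def)

lemma (in ring) hmat_mult:
  assumes "s \<in> triples R" "t \<in> triples R"
  shows "hmat R s \<otimes>\<^bsub>heisenberg R\<^esub> hmat R t = hmat R (hmult R s t)"
proof -
  obtain x y z x' y' z' where st: "s = (x, y, z)" "t = (x', y', z')"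
    by (metis prod.exhaust)
  have cl: "x \<in> carrier R" "y \<in> carrier R" "z \<in> carrier R" "x' \<in> carrier R" "y' \<in> carrier R" "z' \<in> carrier R"
    using assms by (auto simp: st triples_def)
  have sum3: "(\<Oplus>k\<in>UNIV. f k) = f 1 \<oplus> (f 2 \<oplus> f 3)" if "f \<in> UNIV \<rightarrow> carrier R" for f :: "3 \<Rightarrow> 'a"
  proof -
    have "f 1 \<in> carrier R" "f 2 \<in> carrier R" "f 3 \<in> carrier R"
      using that by auto
    then show ?thesis
      unfolding UNIV_3 by simp
  qed
  show ?thesis
    using cl
    by (auto simp: st heisenberg_def vec_eq_iff forall_3 hmat_def hmult_def sum3 Pi_iff a_ac)
qed

lemma (in ring) hmat_one: "\<one>\<^bsub>heisenberg R\<^esub> = hmat R (\<zero>, \<zero>, \<zero>)"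
  by (simp add: vec_eq_iff forall_3 hmat_def heisenberg_def)

lemma (in ring) hmult_closed: "s \<in> triples R \<Longrightarrow> t \<in> triples R \<Longrightarrow> hmult R s t \<in> triples R"
  by (auto simp: triples_def hmult_def)

lemma (in cring) heisenberg_group: "group (heisenberg R)"
proof -
  have E: "\<exists>t\<in>triples R. A = hmat R t" if "A \<in> carrier (heisenberg R)" for A
    using that hmat_hcoords hcoords_carrier by metis
  show ?thesis
  proof (rule groupI)
    fix A B assume "A \<in> carrier (heisenberg R)" "B \<in> carrier (heisenberg R)"
    then obtain s t where "s \<in> triples R" "t \<in> triples R" "A = hmat R s" "B = hmat R t"
      using E by metis
    then show "A \<otimes>\<^bsub>heisenberg R\<^esub> B \<in> carrier (heisenberg R)"
      by (simp add: hmat_mult hmat_carrier hmult_closed)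
  next
    show "\<one>\<^bsub>heisenberg R\<^esub> \<in> carrier (heisenberg R)"
      by (simp add: hmat_one hmat_carrier triples_def)
  next
    fix A B C
    assume "A \<in> carrier (heisenberg R)" "B \<in> carrier (heisenberg R)" "C \<in> carrier (heisenberg R)"
    then obtain r s t where *: "r \<in> triples R" "s \<in> triples R" "t \<in> triples R"
      "A = hmat R r" "B = hmat R s" "C = hmat R t"
      using E by metis
    have "hmult R (hmult R r s) t = hmult R r (hmult R s t)"
      using *(1-3) by (auto simp: hmult_def triples_def a_ac l_distr r_distr)
    then show "A \<otimes>\<^bsub>heisenberg R\<^esub> B \<otimes>\<^bsub>heisenberg R\<^esub> C = A \<otimes>\<^bsub>heisenberg R\<^esub> (B \<otimes>\<^bsub>heisenberg R\<^esub> C)"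
      using * by (simp add: hmat_mult hmult_closed)
  next
    fix A assume "A \<in> carrier (heisenberg R)"
    then obtain t where t: "t \<in> triples R" "A = hmat R t"
      using E by metis
    obtain x y z where xyz: "t = (x, y, z)" "x \<in> carrier R" "y \<in> carrier R" "z \<in> carrier R"
      using t(1) by (auto simp: triples_def)
    have o: "(\<zero>, \<zero>, \<zero>) \<in> triples R"
      by (simp add: triples_def)
    show "\<one>\<^bsub>heisenberg R\<^esub> \<otimes>\<^bsub>heisenberg R\<^esub> A = A"
    proof -
      have "hmult R (\<zero>, \<zero>, \<zero>) t = t"
        using xyz by (simp add: hmult_def)
      then show ?thesis
        by (simp add: hmat_one t hmat_mult o)
    qed
    \<comment> \<open>The corner entry solves
      \<open>u \<oplus> z \<oplus> (\<ominus> x) \<otimes> y = \<zero>\<close> for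
      \<open>u\<close>.\<close>
    let ?i = "(\<ominus> x, \<ominus> y, x \<otimes> y \<ominus> z)"
    have i: "?i \<in> triples R"
      using xyz by (simp add: triples_def)
    have "x \<otimes> y \<ominus> z \<oplus> z \<oplus> \<ominus> x \<otimes> y = \<zero>"
      using xyz by algebra
    then have "hmult R ?i t = (\<zero>, \<zero>, \<zero>)"
      using xyz by (simp add: hmult_def l_neg)
    then have "hmat R ?i \<otimes>\<^bsub>heisenberg R\<^esub> A = \<one>\<^bsub>heisenberg R\<^esub>"
      by (simp add: hmat_one t hmat_mult i)
    then show "\<exists>B\<in>carrier (heisenberg R). B \<otimes>\<^bsub>heisenberg R\<^esub> A = \<one>\<^bsub>heisenberg R\<^esub>"
      using hmat_carrier[OF i] by blast
  qed
qed

definition hmap ::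
  "('a, 'm) ring_scheme \<Rightarrow> ('a \<times> 'a \<times> 'a \<Rightarrow> 'a \<times> 'a \<times> 'a) \<Rightarrow> 'a^3^3 \<Rightarrow> 'a^3^3" where
  "hmap K F A = hmat K (F (hcoords A))"

text \<open>Reduces the construction of group automorphisms to identities between triples;
  \<open>G\<close> is a two-sided inverse and provides bijectivity.\<close>

lemma (in cring) hmap_auto:
  assumes F: "\<And>t. t \<in> triples R \<Longrightarrow> F t \<in> triples R"
    and G: "\<And>t. t \<in> triples R \<Longrightarrow> G t \<in> triples R"
    and FG: "\<And>t. t \<in> triples R \<Longrightarrow> F (G t) = t" "\<And>t. t \<in> triples R \<Longrightarrow> G (F t) = t"
    and hom: "\<And>s t. s \<in> triples R \<Longrightarrow> t \<in> triples R \<Longrightarrow> F (hmult R s t) = hmult R (F s) (F t)"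
  shows "hmap R F \<in> autos (group_structure (heisenberg R))"
proof (rule autos_group_structure[OF heisenberg_group])
  show "hmap R F \<in> hom (heisenberg R) (heisenberg R)"
  proof (rule homI)
    show "hmap R F A \<in> carrier (heisenberg R)" if "A \<in> carrier (heisenberg R)" for A
      using that by (simp add: hmap_def hmat_carrier hcoords_carrier F)
    fix A B assume *: "A \<in> carrier (heisenberg R)" "B \<in> carrier (heisenberg R)"
    have "A \<otimes>\<^bsub>heisenberg R\<^esub> B = hmat R (hmult R (hcoords A) (hcoords B))"
      using * by (metis hmat_mult hmat_hcoords hcoords_carrier)
    then show "hmap R F (A \<otimes>\<^bsub>heisenberg R\<^esub> B) = hmap R F A \<otimes>\<^bsub>heisenberg R\<^esub> hmap R F B"
      using * by (simp add: hmap_def hcoords_hmat hom hcoords_carrier hmat_mult F)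
  qed
  show "bij_betw (hmap R F) (carrier (heisenberg R)) (carrier (heisenberg R))"
    by (rule bij_betw_byWitness[where f' = "hmap R G"])
       (auto simp: hmap_def hcoords_hmat hcoords_carrier hmat_carrier hmat_hcoords F G FG)
qed

lemma hmap_hmap: "hmap K F (hmap K G A) = hmap K (F \<circ> G) A"
  by (simp add: hmap_def hcoords_hmat)

text \<open>Multiplication of each element by the central element with coordinates (0, 0, f x),
  which respects products as soon as \<open>f\<close> is additive.\<close>

definition shear :: "('a, 'm) ring_scheme \<Rightarrow> ('a \<Rightarrow> 'a) \<Rightarrow> 'a \<times> 'a \<times> 'a \<Rightarrow> 'a \<times> 'a \<times> 'a" where
  "shear K f = (\<lambda>(x, y, z). (x, y, z \<oplus>\<^bsub>K\<^esub> f x))"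

lemma (in cring) shear_auto:
  assumes f: "\<And>x. x \<in> carrier R \<Longrightarrow> f x \<in> carrier R"
    and add: "\<And>x y. x \<in> carrier R \<Longrightarrow> y \<in> carrier R \<Longrightarrow> f (x \<oplus> y) = f x \<oplus> f y"
  shows "hmap R (shear R f) \<in> autos (group_structure (heisenberg R))"
proof (rule hmap_auto[where G = "shear R (\<lambda>x. \<ominus> f x)"])
  fix s t assume "s \<in> triples R" "t \<in> triples R"
  then show "shear R f (hmult R s t) = hmult R (shear R f s) (shear R f t)"
    by (auto simp: triples_def hmult_def shear_def f add a_ac)
qed (auto simp: triples_def shear_def f a_assoc r_neg l_neg)

text \<open>Modulo the centre this is the map (x, y) -> (y, -x) of determinant 1. Subtracting x y in
  the corner compensates for the term x y' of \<open>hmult\<close> turning into -y x'.\<close>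

definition rotation :: "('a, 'm) ring_scheme \<Rightarrow> 'a \<times> 'a \<times> 'a \<Rightarrow> 'a \<times> 'a \<times> 'a" where
  "rotation K = (\<lambda>(x, y, z). (y, \<ominus>\<^bsub>K\<^esub> x, z \<ominus>\<^bsub>K\<^esub> x \<otimes>\<^bsub>K\<^esub> y))"

text \<open>The two corner corrections cancel, as z - x y - y (-x) = z. What remains is nontrivial
  precisely when -1 differs from 1.\<close>

lemma (in cring) rotation_square:
  "t \<in> triples R \<Longrightarrow> rotation R (rotation R t) = (\<lambda>(x, y, z). (\<ominus> x, \<ominus> y, z)) t"
  by (auto simp: rotation_def triples_def) algebra

lemma (in cring) rotation_triples: "t \<in> triples R \<Longrightarrow> rotation R t \<in> triples R"
  by (auto simp: rotation_def triples_def)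

lemma (in cring) rotation_order:
  assumes "t \<in> triples R"
  shows "rotation R (rotation R (rotation R (rotation R t))) = t"
proof -
  obtain x y z where t: "t = (x, y, z)" and cl: "x \<in> carrier R" "y \<in> carrier R" "z \<in> carrier R"
    using assms by (auto simp: triples_def)
  then have "(\<ominus> x, \<ominus> y, z) \<in> triples R"
    by (simp add: triples_def)
  then show ?thesis
    using rotation_square[OF assms] rotation_square[of "(\<ominus> x, \<ominus> y, z)"] cl by (simp add: t)
qed

lemma (in cring) rotation_auto: "hmap R (rotation R) \<in> autos (group_structure (heisenberg R))"
proof (rule hmap_auto[where G = "\<lambda>t. rotation R (rotation R (rotation R t))"])
  fix s t assume "s \<in> triples R" "t \<in> triples R"
  then obtain x y z x' y' z' where st: "s = (x, y, z)" "t = (x', y', z')"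
    and cl: "x \<in> carrier R" "y \<in> carrier R" "z \<in> carrier R" "x' \<in> carrier R" "y' \<in> carrier R" "z' \<in> carrier R"
    by (auto simp: triples_def)
  have "\<ominus> (x \<oplus> x') = \<ominus> x \<oplus> \<ominus> x'"
    using cl by algebra
  moreover have "(z \<oplus> z' \<oplus> x \<otimes> y') \<ominus> (x \<oplus> x') \<otimes> (y \<oplus> y')
    = (z \<ominus> x \<otimes> y) \<oplus> (z' \<ominus> x' \<otimes> y') \<oplus> y \<otimes> (\<ominus> x')"
    using cl by algebra
  ultimately show "rotation R (hmult R s t) = hmult R (rotation R s) (rotation R t)"
    by (simp add: hmult_def rotation_def st)
qed (simp_all add: rotation_order rotation_triples)

text \<open>Scaling the first coordinate scales the term x y' of \<open>hmult\<close>, so the corner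
  has to be scaled by the same factor.\<close>

definition scaling :: "('a, 'm) ring_scheme \<Rightarrow> 'a \<Rightarrow> 'a \<times> 'a \<times> 'a \<Rightarrow> 'a \<times> 'a \<times> 'a" where
  "scaling K c = (\<lambda>(x, y, z). (c \<otimes>\<^bsub>K\<^esub> x, y, c \<otimes>\<^bsub>K\<^esub> z))"

lemma (in cring) scaling_auto:
  assumes c: "c \<in> carrier R" "d \<in> carrier R" "c \<otimes> d = \<one>"
  shows "hmap R (scaling R c) \<in> autos (group_structure (heisenberg R))"
proof (rule hmap_auto[where G = "scaling R d"])
  have cd: "c \<otimes> (d \<otimes> x) = x" "d \<otimes> (c \<otimes> x) = x" if "x \<in> carrier R" for x
    using c that by (simp_all add: m_assoc[symmetric] m_comm[of d c])
  fix t assume "t \<in> triples R"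
  then show "scaling R c (scaling R d t) = t" "scaling R d (scaling R c t) = t"
    using cd by (auto simp: triples_def scaling_def)
next
  fix s t assume "s \<in> triples R" "t \<in> triples R"
  then show "scaling R c (hmult R s t) = hmult R (scaling R c s) (scaling R c t)"
    using c by (auto simp: triples_def hmult_def scaling_def r_distr m_assoc)
qed (use c in \<open>auto simp: triples_def scaling_def\<close>)


section \<open>Endomorphisms of a field bi-interpretable with its Heisenberg group\<close>

locale heisenberg_bi = field R for R :: "('a, 'm) ring_scheme" (structure) +
  assumes bi: "bi_interpretable (ring_structure R) (group_structure (heisenberg R))"
begin

abbreviation H where "H \<equiv> heisenberg R"

text \<open>Fixing one interpretation turns the induced endomorphism into a function of the
  automorphism alone. The definable isomorphism in the second conjunct is what makes the action
  faithful.\<close>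

definition K_in_H :: "('a^3^3, 'a) interp" where
  "K_in_H = (SOME \<Delta>. interprets (group_structure H) (ring_structure R) \<Delta> \<and>
     (\<exists>\<Gamma>. interprets (ring_structure R) (group_structure H) \<Gamma> \<and>
        definable_iso (group_structure H) (comp_interp \<Delta> \<Gamma>)))"

definition \<Phi> :: "('a^3^3 \<Rightarrow> 'a^3^3) \<Rightarrow> 'a \<Rightarrow> 'a" where
  "\<Phi> = induced K_in_H"

lemma K_in_H:
  "interprets (group_structure H) (ring_structure R) K_in_H"
  "\<exists>\<Gamma>. interprets (ring_structure R) (group_structure H) \<Gamma> \<and>
     definable_iso (group_structure H) (comp_interp K_in_H \<Gamma>)"
proof -
  have "\<exists>\<Delta>. interprets (group_structure H) (ring_structure R) \<Delta> \<and>
     (\<exists>\<Gamma>. interprets (ring_structure R) (group_structure H) \<Gamma> \<and>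
        definable_iso (group_structure H) (comp_interp \<Delta> \<Gamma>))"
    using bi by (auto simp: bi_interpretable_def)
  from someI_ex[OF this]
  show "interprets (group_structure H) (ring_structure R) K_in_H"
    "\<exists>\<Gamma>. interprets (ring_structure R) (group_structure H) \<Gamma> \<and>
     definable_iso (group_structure H) (comp_interp K_in_H \<Gamma>)"
    unfolding K_in_H_def by blast+
qed

sublocale KH: struct_interp "group_structure H" "ring_structure R" K_in_H
  using K_in_H(1) fun_closed_ring_structure[OF ring_axioms]
    fun_closed_group_structure[OF heisenberg_group]
  by unfold_locales

lemma structure_univ [simp]: "univ (ring_structure R) = carrier R" "univ (group_structure H) = carrier H"
  by (simp_all add: ring_structure_def group_structure_def)

lemma \<Phi>_hom: "\<beta> \<in> autos (group_structure H) \<Longrightarrow> \<Phi> \<beta> \<in> ring_hom R R"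
  by (simp add: \<Phi>_def KH.induced_endo endos_ring_structure)

lemma \<Phi>_closed: "\<beta> \<in> autos (group_structure H) \<Longrightarrow> m \<in> carrier R \<Longrightarrow> \<Phi> \<beta> m \<in> carrier R"
  using \<Phi>_hom ring_hom_closed by metis

lemma \<Phi>_comp:
  assumes "\<beta> \<in> autos (group_structure H)" "\<gamma> \<in> autos (group_structure H)" "m \<in> carrier R"
  shows "\<Phi> (\<beta> \<circ> \<gamma>) m = \<Phi> \<beta> (\<Phi> \<gamma> m)"
  using KH.induced_comp assms by (simp add: \<Phi>_def)

text \<open>Being the identity is required on the group only: maps of the form
  \<open>hmap R F\<close> rewrite every matrix outside the group into unitriangular shape, so they
  are never literally \<open>id\<close>.\<close>

lemma \<Phi>_id:
  assumes "\<beta> \<in> autos (group_structure H)" "\<And>A. A \<in> carrier H \<Longrightarrow> \<beta> A = A" "m \<in> carrier R"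
  shows "\<Phi> \<beta> m = m"
  using KH.induced_cong[OF assms(1) id_autos] KH.induced_id assms(2,3) by (simp add: \<Phi>_def)

lemma \<Phi>_inj:
  assumes "\<beta> \<in> autos (group_structure H)" "\<gamma> \<in> autos (group_structure H)"
    and "\<And>m. m \<in> carrier R \<Longrightarrow> \<Phi> \<beta> m = \<Phi> \<gamma> m" "A \<in> carrier H"
  shows "\<beta> A = \<gamma> A"
  using KH.induced_inj[OF _ _ assms(1,2)] K_in_H(2) assms(3,4) by (auto simp: \<Phi>_def)

lemma \<Phi>_fixes:
  assumes S: "finite S" "S \<subseteq> carrier R"
  obtains T where "finite T" "T \<subseteq> carrier H"
    "\<And>\<beta>. \<beta> \<in> autos (group_structure H) \<Longrightarrow> \<forall>t\<in>T. \<beta> t = t \<Longrightarrow> \<forall>s\<in>S. \<Phi> \<beta> s = s"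
  by (rule KH.induced_fixes[of S]) (use S in \<open>auto simp: \<Phi>_def\<close>)

text \<open>The endomorphism is induced by the rotation. If its square were trivial, faithfulness
  would make the squared rotation trivial, yet that map sends (1, 0, 0) to (-1, 0, 0).\<close>

lemma endo_of_order_4:
  assumes "\<one> \<oplus> \<one> \<noteq> \<zero>"
  obtains \<phi> x where "\<phi> \<in> ring_hom R R" "x \<in> carrier R" "\<phi> (\<phi> x) \<noteq> x"
    "\<And>y. y \<in> carrier R \<Longrightarrow> \<phi> (\<phi> (\<phi> (\<phi> y))) = y"
proof -
  define \<rho> where "\<rho> = hmap R (rotation R)"
  have \<rho>: "\<rho> \<in> autos (group_structure H)"
    by (simp add: \<rho>_def rotation_auto)
  have \<rho>2: "\<rho> \<circ> \<rho> \<in> autos (group_structure H)"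
    by (rule autos_comp[OF \<rho> \<rho>])
  have "(\<rho> \<circ> \<rho> \<circ> (\<rho> \<circ> \<rho>)) A = A" if "A \<in> carrier H" for A
    using that by (simp add: \<rho>_def hmap_hmap)
      (simp add: hmap_def rotation_order hcoords_carrier hmat_hcoords)
  then have order4: "\<Phi> \<rho> (\<Phi> \<rho> (\<Phi> \<rho> (\<Phi> \<rho> y))) = y" if "y \<in> carrier R" for y
    using \<Phi>_id[OF autos_comp[OF \<rho>2 \<rho>2] _ that] that
    by (simp add: \<Phi>_comp[OF \<rho>2 \<rho>2] \<Phi>_comp[OF \<rho> \<rho>] \<Phi>_closed[OF \<rho>])
  have "\<exists>x\<in>carrier R. \<Phi> \<rho> (\<Phi> \<rho> x) \<noteq> x"
  proof (rule ccontr)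
    assume "\<not> ?thesis"
    then have triv: "\<Phi> (\<rho> \<circ> \<rho>) x = \<Phi> id x" if "x \<in> carrier R" for x
      using that \<Phi>_comp[OF \<rho> \<rho>] \<Phi>_id[OF id_autos] by auto
    have t: "(\<one>, \<zero>, \<zero>) \<in> triples R"
      by (simp add: triples_def)
    have "(\<rho> \<circ> \<rho>) (hmat R (\<one>, \<zero>, \<zero>)) = id (hmat R (\<one>, \<zero>, \<zero>))"
      by (rule \<Phi>_inj[OF \<rho>2 id_autos triv]) (simp_all add: hmat_carrier t)
    then have "hmat R (\<ominus> \<one>, \<zero>, \<zero>) = hmat R (\<one>, \<zero>, \<zero>)"
      by (simp add: \<rho>_def hmap_hmap) (simp add: hmap_def hcoords_hmat rotation_square t)
    then have "\<ominus> \<one> = \<one>"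
      by (metis hcoords_hmat prod.inject)
    then show False
      using assms by (metis one_closed r_neg)
  qed
  then show thesis
    using that[OF \<Phi>_hom[OF \<rho>]] order4 by blast
qed

text \<open>The endomorphism is induced by scaling with \<open>c\<close>, which moves (1, 0, 0) to
  (c, 0, 0); faithfulness keeps it nontrivial.\<close>

lemma endo_of_order_3:
  assumes c: "c \<in> carrier R" "c \<noteq> \<one>" "c \<otimes> c \<otimes> c = \<one>"
  obtains \<phi> x where "\<phi> \<in> ring_hom R R" "x \<in> carrier R" "\<phi> x \<noteq> x"
    "\<And>y. y \<in> carrier R \<Longrightarrow> \<phi> (\<phi> (\<phi> y)) = y"
proof -
  define \<rho> where "\<rho> = hmap R (scaling R c)"
  have \<rho>: "\<rho> \<in> autos (group_structure H)"
    using c by (simp add: \<rho>_def scaling_auto[of c "c \<otimes> c"] m_assoc)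
  have \<rho>2: "\<rho> \<circ> \<rho> \<in> autos (group_structure H)"
    by (rule autos_comp[OF \<rho> \<rho>])
  have ccc: "c \<otimes> (c \<otimes> (c \<otimes> x)) = x" if "x \<in> carrier R" for x
    using c that by (simp add: m_assoc[symmetric])
  have "(\<rho> \<circ> (\<rho> \<circ> \<rho>)) A = A" if "A \<in> carrier H" for A
  proof -
    have "scaling R c (scaling R c (scaling R c (hcoords A))) = hcoords A"
      using hcoords_carrier[OF that] ccc by (auto simp: scaling_def triples_def)
    then show ?thesis
      using that by (simp add: \<rho>_def hmap_hmap) (simp add: hmap_def hmat_hcoords)
  qed
  then have order3: "\<Phi> \<rho> (\<Phi> \<rho> (\<Phi> \<rho> y)) = y" if "y \<in> carrier R" for y
    using \<Phi>_id[OF autos_comp[OF \<rho> \<rho>2] _ that] that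
    by (simp add: \<Phi>_comp[OF \<rho> \<rho>2] \<Phi>_comp[OF \<rho> \<rho>] \<Phi>_closed[OF \<rho>])
  have "\<exists>x\<in>carrier R. \<Phi> \<rho> x \<noteq> x"
  proof (rule ccontr)
    assume "\<not> ?thesis"
    then have triv: "\<Phi> \<rho> x = \<Phi> id x" if "x \<in> carrier R" for x
      using that \<Phi>_id[OF id_autos] by auto
    have t: "(\<one>, \<zero>, \<zero>) \<in> triples R"
      by (simp add: triples_def)
    have "\<rho> (hmat R (\<one>, \<zero>, \<zero>)) = id (hmat R (\<one>, \<zero>, \<zero>))"
      by (rule \<Phi>_inj[OF \<rho> id_autos triv]) (simp_all add: hmat_carrier t)
    then have "hmat R (c, \<zero>, \<zero>) = hmat R (\<one>, \<zero>, \<zero>)"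
      using c by (simp add: \<rho>_def hmap_def hcoords_hmat scaling_def)
    then show False
      using c by (metis hcoords_hmat prod.inject)
  qed
  then show thesis
    using that[OF \<Phi>_hom[OF \<rho>]] order3 by blast
qed

end


section \<open>Endomorphisms of finite order\<close>

context field
begin

lemma no_endo_of_order_4:
  assumes two: "\<one> \<oplus> \<one> \<noteq> \<zero>"
    and sq: "\<And>a. a \<in> carrier R \<Longrightarrow> \<exists>r\<in>carrier R. \<exists>b\<in>carrier R.
        (\<forall>\<phi>\<in>ring_hom R R. \<phi> r = r) \<and> a = r \<otimes> (b \<otimes> b)"
    and \<phi>: "\<phi> \<in> ring_hom R R"
    and order: "\<And>y. y \<in> carrier R \<Longrightarrow> \<phi> (\<phi> (\<phi> (\<phi> y))) = y"
    and x: "x \<in> carrier R"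
  shows "\<phi> (\<phi> x) = x"
proof (rule ccontr)
  assume ne: "\<phi> (\<phi> x) \<noteq> x"
  interpret \<phi>: ring_hom_ring R R \<phi>
    using \<phi> ring_axioms by (simp add: ring_hom_ring_def ring_hom_ring_axioms_def)
  define \<tau> where "\<tau> = (\<lambda>x. \<phi> (\<phi> x))"
  interpret \<tau>: ring_hom_ring R R \<tau>
    using ring_hom_trans[OF \<phi> \<phi>] ring_axioms
    by (simp add: ring_hom_ring_def ring_hom_ring_axioms_def \<tau>_def comp_def)
  have \<tau>2: "\<tau> (\<tau> y) = y" if "y \<in> carrier R" for y
    using order[OF that] by (simp add: \<tau>_def)
  \<comment> \<open>An element negated by the involution \<open>\<tau>\<close>, nonzero because
    \<open>\<tau>\<close> moves \<open>x\<close>.\<close>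
  define a where "a = x \<ominus> \<tau> x"
  have a: "a \<in> carrier R" "a \<noteq> \<zero>" "\<tau> a = \<ominus> a"
  proof -
    show "a \<in> carrier R" "a \<noteq> \<zero>"
      using x ne by (simp_all add: a_def \<tau>_def)
    have "\<tau> a = \<tau> x \<ominus> x"
      using x \<tau>2 by (simp add: a_def a_minus_def)
    also have "\<dots> = \<ominus> a"
      using x \<tau>.hom_closed[OF x] unfolding a_def by algebra
    finally show "\<tau> a = \<ominus> a" .
  qed
  obtain r b where rb: "r \<in> carrier R" "b \<in> carrier R" "\<phi> r = r" "a = r \<otimes> (b \<otimes> b)"
    using sq[OF a(1)] \<phi> by blast
  have nz: "r \<noteq> \<zero>" "b \<noteq> \<zero>"
    using a(2) rb by auto
  \<comment> \<open>The factor by which \<open>\<tau>\<close> multiplies \<open>b\<close>. Applying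
    \<open>\<tau>\<close> to \<open>a = r \<otimes> (b \<otimes> b)\<close>, where \<open>r\<close>
    is fixed, shows that its square is -1.\<close>
  define j where "j = \<tau> b \<otimes> inv b"
  have invb: "inv b \<in> carrier R" "inv b \<otimes> b = \<one>"
    using nz(2) rb(2) field_Units by auto
  have j: "j \<in> carrier R" "\<tau> b = j \<otimes> b"
    using rb(2) invb by (simp_all add: j_def m_assoc)
  have "r \<otimes> (\<tau> b \<otimes> \<tau> b) = \<ominus> (r \<otimes> (b \<otimes> b))"
    using a(3) rb by (simp add: \<tau>_def)
  then have "(r \<otimes> (b \<otimes> b)) \<otimes> (j \<otimes> j) = (r \<otimes> (b \<otimes> b)) \<otimes> \<ominus> \<one>"
    unfolding j(2) using rb(1,2) j(1) by (simp add: m_ac r_minus)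
  then have jj: "j \<otimes> j = \<ominus> \<one>"
    using m_lcancel[OF a(2)] a(1) rb(4) j(1) by simp
  \<comment> \<open>The image of \<open>j\<close> is again a square root of -1, hence
    \<open>j\<close> or its negative; applying \<open>\<phi>\<close> twice returns \<open>j\<close>
    in both cases.\<close>
  have "\<phi> j \<otimes> \<phi> j = \<ominus> \<one>"
    using jj j(1) by (metis \<phi>.hom_mult \<phi>.hom_one \<phi>.hom_a_inv one_closed)
  then have "(\<phi> j \<ominus> j) \<otimes> (\<phi> j \<oplus> j) = \<zero>"
  proof -
    have "(\<phi> j \<ominus> j) \<otimes> (\<phi> j \<oplus> j) = \<phi> j \<otimes> \<phi> j \<ominus> j \<otimes> j"
      using j(1) \<phi>.hom_closed[OF j(1)] by algebra
    then show ?thesis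
      using jj \<open>\<phi> j \<otimes> \<phi> j = \<ominus> \<one>\<close> by (simp add: a_minus_def l_neg r_neg)
  qed
  then have "\<phi> j = j \<or> \<phi> j = \<ominus> j"
    using j(1) by (metis \<phi>.hom_closed a_closed add.inv_equality integral minus_closed r_right_minus_eq)
  then have "\<tau> j = j"
    using j(1) by (auto simp: \<tau>_def)
  \<comment> \<open>As \<open>\<tau>\<close> is an involution fixing \<open>j\<close>, applying it
    twice to \<open>b\<close> multiplies \<open>b\<close> by the square of \<open>j\<close>, that is
    by -1.\<close>
  then have "b = j \<otimes> (j \<otimes> b)"
    using \<tau>2[OF rb(2)] j rb(2) by simp
  also have "\<dots> = \<ominus> b"
    using j(1) rb(2) jj by (simp add: m_assoc[symmetric] l_minus)
  finally have "b \<otimes> (\<one> \<oplus> \<one>) = \<zero>"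
    using rb(2) by (metis one_closed r_distr r_neg r_one)
  then show False
    using two nz(2) rb(2) integral by auto
qed

text \<open>The quadratic equation leaves \<open>t\<close> and
  \<open>\<ominus> (t \<oplus> \<one>)\<close> as the only candidates for the image of
  \<open>t\<close>. A map exchanging them would return \<open>t\<close> after two steps,
  contradicting the return after three.\<close>

lemma endo_fixes_cube_root:
  assumes \<phi>: "\<phi> \<in> ring_hom R R"
    and order: "\<And>y. y \<in> carrier R \<Longrightarrow> \<phi> (\<phi> (\<phi> y)) = y"
    and t: "t \<in> carrier R" "t \<otimes> t \<oplus> t \<oplus> \<one> = \<zero>"
  shows "\<phi> t = t"
proof (rule ccontr)
  assume ne: "\<phi> t \<noteq> t"
  interpret \<phi>: ring_hom_ring R R \<phi>
    using \<phi> ring_axioms by (simp add: ring_hom_ring_def ring_hom_ring_axioms_def)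
  have "\<phi> (t \<otimes> t \<oplus> t \<oplus> \<one>) = \<zero>"
    using t(2) \<phi>.hom_zero by metis
  then have st: "\<phi> t \<otimes> \<phi> t \<oplus> \<phi> t \<oplus> \<one> = \<zero>"
    using t(1) by simp
  have "(\<phi> t \<ominus> t) \<otimes> (\<phi> t \<oplus> t \<oplus> \<one>) = (\<phi> t \<otimes> \<phi> t \<oplus> \<phi> t \<oplus> \<one>) \<ominus> (t \<otimes> t \<oplus> t \<oplus> \<one>)"
    using t(1) \<phi>.hom_closed[OF t(1)] by algebra
  then have "(\<phi> t \<ominus> t) \<otimes> (\<phi> t \<oplus> t \<oplus> \<one>) = \<zero>"
    unfolding st t(2) by simp
  then have "\<phi> t \<oplus> t \<oplus> \<one> = \<zero>"
    using ne t(1) integral[of "\<phi> t \<ominus> t"] by auto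
  then have s: "\<phi> t = \<ominus> (t \<oplus> \<one>)"
    using t(1) by (metis \<phi>.hom_closed a_assoc a_closed minus_equality one_closed)
  have s2: "\<phi> (\<phi> t) = t"
  proof -
    have "\<phi> (\<phi> t) = \<ominus> (\<ominus> (t \<oplus> \<one>) \<oplus> \<one>)"
      using t(1) by (simp add: s)
    also have "\<dots> = t"
      using t(1) by algebra
    finally show ?thesis .
  qed
  show False
    using order[OF t(1)] s2 ne by simp
qed

text \<open>Kummer theory by Lagrange resolvents. A nonzero resolvent is multiplied by
  \<open>w \<otimes> w\<close> under \<open>\<phi>\<close>; following its cube root through three
  applications of \<open>\<phi>\<close> gives a contradiction. So the resolvents for both primitive
  cube roots of unity vanish, and their sum forces \<open>\<phi>\<close> to fix
  \<open>x\<close>.\<close>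

lemma no_endo_of_order_3:
  assumes two: "\<one> \<oplus> \<one> = \<zero>"
    and cube: "\<And>a. a \<in> carrier R \<Longrightarrow> \<exists>b\<in>carrier R. b \<otimes> b \<otimes> b = a"
    and z: "z \<in> carrier R" "z \<otimes> z \<oplus> z \<oplus> \<one> = \<zero>"
    and \<phi>: "\<phi> \<in> ring_hom R R"
    and order: "\<And>y. y \<in> carrier R \<Longrightarrow> \<phi> (\<phi> (\<phi> y)) = y"
    and x: "x \<in> carrier R"
  shows "\<phi> x = x"
proof -
  interpret \<phi>: ring_hom_ring R R \<phi>
    using \<phi> ring_axioms by (simp add: ring_hom_ring_def ring_hom_ring_axioms_def)
  have root_cube: "t \<otimes> t \<otimes> t = \<one>" if "t \<in> carrier R" "t \<otimes> t \<oplus> t \<oplus> \<one> = \<zero>" for t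
  proof -
    have "t \<otimes> t \<otimes> t \<ominus> \<one> = (t \<ominus> \<one>) \<otimes> (t \<otimes> t \<oplus> t \<oplus> \<one>)"
      using that(1) by algebra
    then show ?thesis
      using that by simp
  qed
  have fixes_cube_root: "\<phi> t = t" if "t \<in> carrier R" "t \<otimes> t \<otimes> t = \<one>" for t
  proof (cases "t = \<one>")
    case False
    have "(t \<ominus> \<one>) \<otimes> (t \<otimes> t \<oplus> t \<oplus> \<one>) = t \<otimes> t \<otimes> t \<ominus> \<one>"
      using that(1) by algebra
    then have "(t \<ominus> \<one>) \<otimes> (t \<otimes> t \<oplus> t \<oplus> \<one>) = \<zero>"
      using that by simp
    then have "t \<otimes> t \<oplus> t \<oplus> \<one> = \<zero>"
      using False that(1) integral[of "t \<ominus> \<one>"] by auto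
    then show ?thesis
      using endo_fixes_cube_root[OF \<phi> order that(1)] by blast
  qed simp
  have resolvent: "x \<oplus> w \<otimes> \<phi> x \<oplus> w \<otimes> w \<otimes> \<phi> (\<phi> x) = \<zero>"
    if w: "w \<in> carrier R" "w \<otimes> w \<oplus> w \<oplus> \<one> = \<zero>" for w
  proof (rule ccontr)
    define a where "a = x \<oplus> w \<otimes> \<phi> x \<oplus> w \<otimes> w \<otimes> \<phi> (\<phi> x)"
    assume "\<not> ?thesis"
    then have nz: "a \<noteq> \<zero>"
      by (simp add: a_def)
    have a: "a \<in> carrier R"
      using w x by (simp add: a_def)
    have w3: "w \<otimes> w \<otimes> w = \<one>" and \<phi>w: "\<phi> w = w"
      using root_cube[OF w] fixes_cube_root[OF w(1)] by auto
    have "\<phi> a = \<phi> x \<oplus> w \<otimes> \<phi> (\<phi> x) \<oplus> w \<otimes> w \<otimes> x"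
      using w x order[OF x] \<phi>w by (simp add: a_def)
    moreover have "w \<otimes> w \<otimes> a = (w \<otimes> w \<otimes> w) \<otimes> \<phi> x \<oplus> (w \<otimes> w \<otimes> w) \<otimes> w \<otimes> \<phi> (\<phi> x) \<oplus> w \<otimes> w \<otimes> x"
      using w x \<phi>.hom_closed[OF x] \<phi>.hom_closed[OF \<phi>.hom_closed[OF x]] unfolding a_def by algebra
    ultimately have \<phi>a: "\<phi> a = w \<otimes> w \<otimes> a"
      using w x by (simp add: w3)
    \<comment> \<open>A cube root of the resolvent: \<open>\<phi>\<close> multiplies it by some
      \<open>c\<close> whose cube is \<open>w \<otimes> w\<close>, and multiplies \<open>c\<close>
      by some \<open>e\<close> whose cube is one.\<close>
    obtain b where b: "b \<in> carrier R" "b \<otimes> b \<otimes> b = a"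
      using cube[OF a] by blast
    have nzb: "b \<noteq> \<zero>"
      using nz b by auto
    have quot: "\<exists>q\<in>carrier R. u = q \<otimes> v" if "u \<in> carrier R" "v \<in> carrier R" "v \<noteq> \<zero>" for u v
    proof -
      have "inv v \<in> carrier R" "inv v \<otimes> v = \<one>"
        using that field_Units by auto
      then show ?thesis
        using that by (intro bexI[of _ "u \<otimes> inv v"]) (simp_all add: m_assoc)
    qed
    obtain c where c: "c \<in> carrier R" "\<phi> b = c \<otimes> b"
      using quot[of "\<phi> b" b] b(1) nzb by auto
    have "(b \<otimes> b \<otimes> b) \<otimes> (c \<otimes> c \<otimes> c) = (c \<otimes> b) \<otimes> (c \<otimes> b) \<otimes> (c \<otimes> b)"
      using b(1) c(1) by algebra
    also have "\<dots> = \<phi> (b \<otimes> b \<otimes> b)"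
      using b(1) by (simp add: c(2))
    also have "\<dots> = (b \<otimes> b \<otimes> b) \<otimes> (w \<otimes> w)"
      unfolding b(2) \<phi>a using a w(1) by (simp add: m_comm)
    finally have c3: "c \<otimes> c \<otimes> c = w \<otimes> w"
      using m_lcancel[OF nz a] w(1) c(1) by (simp add: b(2))
    have nzc: "c \<noteq> \<zero>"
    proof
      assume "c = \<zero>"
      then have "w \<otimes> w = \<zero>"
        using c3 by simp
      then show False
        using w3 w(1) one_not_zero by simp
    qed
    obtain e where e: "e \<in> carrier R" "\<phi> c = e \<otimes> c"
      using quot[of "\<phi> c" c] c(1) nzc by auto
    have "(c \<otimes> c \<otimes> c) \<otimes> (e \<otimes> e \<otimes> e) = (e \<otimes> c) \<otimes> (e \<otimes> c) \<otimes> (e \<otimes> c)"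
      using e(1) c(1) by algebra
    also have "\<dots> = \<phi> (c \<otimes> c \<otimes> c)"
      using c(1) by (simp add: e(2))
    also have "\<dots> = (c \<otimes> c \<otimes> c) \<otimes> \<one>"
      using w(1) \<phi>w by (simp add: c3)
    finally have e3: "e \<otimes> e \<otimes> e = \<one>"
      using m_lcancel[of "c \<otimes> c \<otimes> c" "e \<otimes> e \<otimes> e" \<one>] nzc c(1) e(1) by (simp add: integral_iff)
    have \<phi>e: "\<phi> e = e"
      by (rule fixes_cube_root[OF e(1) e3])
    \<comment> \<open>Three applications multiply \<open>b\<close> by the cubes of \<open>e\<close>
      and \<open>c\<close>, in total by \<open>w \<otimes> w\<close>.\<close>
    have "b = \<phi> (\<phi> (\<phi> b))"
      using order[OF b(1)] by simp
    also have "\<dots> = (e \<otimes> (e \<otimes> c)) \<otimes> ((e \<otimes> c) \<otimes> (c \<otimes> b))"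
      using b(1) c e \<phi>e by simp
    also have "\<dots> = (e \<otimes> e \<otimes> e) \<otimes> (c \<otimes> c \<otimes> c) \<otimes> b"
      using b(1) c(1) e(1) by algebra
    also have "\<dots> = b \<otimes> (w \<otimes> w)"
      using b(1) w(1) by (simp add: e3 c3 m_comm)
    finally have "b \<otimes> \<one> = b \<otimes> (w \<otimes> w)"
      using b(1) by simp
    then have "w \<otimes> w = \<one>"
      using m_lcancel[OF nzb b(1), of \<one> "w \<otimes> w"] w(1) by simp
    \<comment> \<open>At one the quadratic reads 1 + 1 + 1 = 0, which is 1 = 0 in characteristic
      2.\<close>
    then have "w = \<one>"
      using w3 w(1) by simp
    then show False
      using w(2) two one_not_zero by simp
  qed
  have z': "(z \<otimes> z) \<in> carrier R" "(z \<otimes> z) \<otimes> (z \<otimes> z) \<oplus> z \<otimes> z \<oplus> \<one> = \<zero>"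
  proof -
    have "(z \<otimes> z) \<otimes> (z \<otimes> z) = (z \<otimes> z \<otimes> z) \<otimes> z"
      using z(1) by algebra
    then have "(z \<otimes> z) \<otimes> (z \<otimes> z) \<oplus> z \<otimes> z \<oplus> \<one> = z \<oplus> z \<otimes> z \<oplus> \<one>"
      using z by (simp add: root_cube)
    then show "(z \<otimes> z) \<otimes> (z \<otimes> z) \<oplus> z \<otimes> z \<oplus> \<one> = \<zero>"
      using z by (simp add: a_ac)
  qed (simp add: z)
  define s t where "s = \<phi> x" and "t = \<phi> (\<phi> x)"
  have st: "s \<in> carrier R" "t \<in> carrier R"
    using x by (simp_all add: s_def t_def)
  \<comment> \<open>The sum of the resolvents for \<open>z\<close> and \<open>z \<otimes> z\<close>
    is 2x - s - t, since each primitive root and its square add up to -1.\<close>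
  have "(x \<oplus> z \<otimes> s \<oplus> z \<otimes> z \<otimes> t) \<oplus> (x \<oplus> z \<otimes> z \<otimes> s \<oplus> z \<otimes> z \<otimes> (z \<otimes> z) \<otimes> t) = \<zero>"
    using resolvent[OF z] resolvent[OF z'] by (simp add: s_def t_def)
  moreover have "(x \<oplus> z \<otimes> s \<oplus> z \<otimes> z \<otimes> t) \<oplus> (x \<oplus> z \<otimes> z \<otimes> s \<oplus> z \<otimes> z \<otimes> (z \<otimes> z) \<otimes> t)
     = (\<one> \<oplus> \<one>) \<otimes> x \<oplus> (z \<otimes> z \<oplus> z \<oplus> \<one>) \<otimes> s \<ominus> s \<oplus> (z \<otimes> z \<otimes> (z \<otimes> z) \<oplus> z \<otimes> z \<oplus> \<one>) \<otimes> t \<ominus> t"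
    using x z(1) st by algebra
  ultimately have n: "\<ominus> s \<ominus> t = \<zero>"
    using x z(1) st by (simp add: two z(2) z'(2) a_minus_def)
  \<comment> \<open>In characteristic 2 the vanishing of -s - t gives s = t; one more application of
    \<open>\<phi>\<close> then brings in \<open>x\<close> by the order assumption.\<close>
  have "s \<ominus> t = (\<one> \<oplus> \<one>) \<otimes> s \<oplus> (\<ominus> s \<ominus> t)"
    using st by algebra
  also have "\<dots> = \<zero>"
    unfolding two n using st by simp
  finally have "s = t"
    using st by simp
  then have "\<phi> (\<phi> (\<phi> x)) = \<phi> (\<phi> x)"
    by (simp add: s_def t_def)
  then show ?thesis
    using order[OF x] \<open>s = t\<close> by (simp add: s_def t_def)
qed

end

section \<open>Square and cube roots in algebraically closed fields\<close>

lemma (in algebraically_closed) exists_root: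
  assumes "P \<in> carrier (poly_ring L)" "degree P > 0"
  obtains x where "x \<in> carrier L" "eval P x = \<zero>"
proof -
  have "roots P \<noteq> {#}"
    using roots_over_carrier[OF assms(1)] assms(2) by (auto simp: splitted_def)
  then obtain x where "x \<in># roots P"
    by blast
  then show thesis
    using that roots_mem_iff_is_root[OF assms(1)] by (auto simp: is_root_def)
qed

lemma (in algebraically_closed) exists_root_2:
  assumes "a \<in> carrier L" "b \<in> carrier L"
  obtains x where "x \<in> carrier L" "x \<otimes> x \<oplus> a \<otimes> x \<oplus> b = \<zero>"
proof -
  \<comment> \<open>Polynomials are coefficient lists with the leading coefficient first.\<close>
  have "[\<one>, a, b] \<in> carrier (poly_ring L)"
    using assms by (simp add: sym[OF univ_poly_carrier] polynomial_def)
  then obtain x where "x \<in> carrier L" "eval [\<one>, a, b] x = \<zero>"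
    by (rule exists_root) simp
  then show thesis
    using that[of x] assms by (simp add: numeral_2_eq_2 a_assoc)
qed

lemma (in algebraically_closed) exists_cube_root:
  assumes "a \<in> carrier L"
  obtains x where "x \<in> carrier L" "x \<otimes> x \<otimes> x = a"
proof -
  have "[\<one>, \<zero>, \<zero>, \<ominus> a] \<in> carrier (poly_ring L)"
    using assms by (simp add: sym[OF univ_poly_carrier] polynomial_def)
  then obtain x where "x \<in> carrier L" "eval [\<one>, \<zero>, \<zero>, \<ominus> a] x = \<zero>"
    by (rule exists_root) simp
  then have "x \<otimes> x \<otimes> x \<ominus> a = \<zero>"
    using assms by (simp add: numeral_3_eq_3 a_minus_def)
  then show thesis
    using that[of x] assms \<open>x \<in> carrier L\<close> by simp
qed

section \<open>Exclusion of algebraically closed and real closed fields\<close>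

context heisenberg_bi
begin

text \<open>In characteristic 2 the squared rotation is trivial, so the scaling by a primitive cube
  root of unity, a root of X^2 + X + 1, takes its place. Otherwise every element is a square and the
  scalar \<open>r\<close> can be one.\<close>

lemma not_algebraically_closed: "\<not> algebraically_closed R"
proof
  assume "algebraically_closed R"
  then interpret algebraically_closed R .
  show False
  proof (cases "\<one> \<oplus> \<one> = \<zero>")
    case True
    obtain z where z: "z \<in> carrier R" "z \<otimes> z \<oplus> \<one> \<otimes> z \<oplus> \<one> = \<zero>"
      using exists_root_2[of \<one> \<one>] by auto
    then have z2: "z \<otimes> z \<oplus> z \<oplus> \<one> = \<zero>"
      by simp
    have "z \<otimes> z \<otimes> z \<ominus> \<one> = (z \<ominus> \<one>) \<otimes> (z \<otimes> z \<oplus> z \<oplus> \<one>)"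
      using z(1) by algebra
    then have "z \<otimes> z \<otimes> z = \<one>"
      using z(1) by (simp add: z2)
    moreover have "z \<noteq> \<one>"
      using z2 True one_not_zero by auto
    ultimately obtain \<phi> x where "\<phi> \<in> ring_hom R R" "x \<in> carrier R" "\<phi> x \<noteq> x"
      "\<And>y. y \<in> carrier R \<Longrightarrow> \<phi> (\<phi> (\<phi> y)) = y"
      using endo_of_order_3[OF z(1)] by metis
    then show False
      using no_endo_of_order_3[OF True _ z(1) z2, of \<phi> x] exists_cube_root by metis
  next
    case False
    obtain \<phi> x where "\<phi> \<in> ring_hom R R" "x \<in> carrier R" "\<phi> (\<phi> x) \<noteq> x"
      "\<And>y. y \<in> carrier R \<Longrightarrow> \<phi> (\<phi> (\<phi> (\<phi> y))) = y"
      using endo_of_order_4[OF False] by metis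
    moreover have "\<exists>r\<in>carrier R. \<exists>b\<in>carrier R.
        (\<forall>\<phi>\<in>ring_hom R R. \<phi> r = r) \<and> a = r \<otimes> (b \<otimes> b)" if a: "a \<in> carrier R" for a
    proof -
      obtain b where b: "b \<in> carrier R" "b \<otimes> b \<oplus> \<zero> \<otimes> b \<oplus> \<ominus> a = \<zero>"
        using exists_root_2[of \<zero> "\<ominus> a"] a by auto
      then have "b \<otimes> b \<ominus> a = \<zero>"
        using a by (simp add: a_minus_def)
      then have "a = \<one> \<otimes> (b \<otimes> b)"
        using a b(1) by simp
      then show ?thesis
        using b(1) ring_hom_one by (metis one_closed)
    qed
    ultimately show False
      using no_endo_of_order_4[OF False] by blast
  qed
qed

lemma not_real_closed: "\<not> real_closed_field R"
proof
  assume "real_closed_field R"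
  then obtain leq where ord: "field_ordering R leq"
    and root: "\<And>x. x \<in> carrier R \<Longrightarrow> leq \<zero> x \<Longrightarrow> \<exists>y\<in>carrier R. y \<otimes> y = x"
    by (auto simp: real_closed_field_def)
  have antisym: "\<forall>x\<in>carrier R. \<forall>y\<in>carrier R. leq x y \<and> leq y x \<longrightarrow> x = y"
    using ord unfolding field_ordering_def by (elim conjE)
  have total: "\<forall>x\<in>carrier R. \<forall>y\<in>carrier R. leq x y \<or> leq y x"
    using ord unfolding field_ordering_def by (elim conjE)
  have add: "\<forall>x\<in>carrier R. \<forall>y\<in>carrier R. \<forall>z\<in>carrier R. leq x y \<longrightarrow> leq (x \<oplus> z) (y \<oplus> z)"
    using ord unfolding field_ordering_def by (elim conjE)
  \<comment> \<open>In characteristic 2, adding one exchanges zero and one, so each would be at most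
    the other.\<close>
  have two: "\<one> \<oplus> \<one> \<noteq> \<zero>"
  proof
    assume two: "\<one> \<oplus> \<one> = \<zero>"
    have "leq (\<zero> \<oplus> \<one>) (\<one> \<oplus> \<one>)" if "leq \<zero> \<one>"
      using add that by blast
    moreover have "leq (\<one> \<oplus> \<one>) (\<zero> \<oplus> \<one>)" if "leq \<one> \<zero>"
      using add that by blast
    ultimately have "leq \<zero> \<one> \<longleftrightarrow> leq \<one> \<zero>"
      using two by auto
    then show False
      using total antisym one_not_zero by (metis one_closed zero_closed)
  qed
  have "\<exists>r\<in>carrier R. \<exists>b\<in>carrier R.
      (\<forall>\<phi>\<in>ring_hom R R. \<phi> r = r) \<and> a = r \<otimes> (b \<otimes> b)" if a: "a \<in> carrier R" for a
  proof (cases "leq \<zero> a")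
    case True
    then obtain b where "b \<in> carrier R" "a = \<one> \<otimes> (b \<otimes> b)"
      using root[OF a] by auto
    then show ?thesis
      using ring_hom_one by (metis one_closed)
  next
    case False
    \<comment> \<open>By totality \<open>a\<close> is at most zero, hence its negative is a square
      and the scalar -1 serves for \<open>a\<close>.\<close>
    then have "leq (a \<oplus> \<ominus> a) (\<zero> \<oplus> \<ominus> a)"
      using add total a by (meson a_inv_closed zero_closed)
    then obtain b where b: "b \<in> carrier R" "b \<otimes> b = \<ominus> a"
      using root[of "\<ominus> a"] a by (auto simp: r_neg)
    have "\<phi> (\<ominus> \<one>) = \<ominus> \<one>" if "\<phi> \<in> ring_hom R R" for \<phi>
    proof -
      interpret \<phi>: ring_hom_ring R R \<phi>
        using that ring_axioms by (simp add: ring_hom_ring_def ring_hom_ring_axioms_def)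
      show ?thesis by simp
    qed
    moreover have "a = \<ominus> \<one> \<otimes> (b \<otimes> b)"
      using a b by (simp add: l_minus)
    ultimately show ?thesis
      using b(1) by (metis one_closed a_inv_closed)
  qed
  moreover obtain \<phi> x where "\<phi> \<in> ring_hom R R" "x \<in> carrier R" "\<phi> (\<phi> x) \<noteq> x"
    "\<And>y. y \<in> carrier R \<Longrightarrow> \<phi> (\<phi> (\<phi> (\<phi> y))) = y"
    using endo_of_order_4[OF two] by metis
  ultimately show False
    using no_endo_of_order_4[OF two] by blast
qed

end


section \<open>Finitely generated fields\<close>

context field
begin

text \<open>Induction over the generation of the subfield; at an inverse both images are inverses of
  the same element.\<close>

lemma endos_agree_on_generate_field:
  assumes \<phi>: "\<phi> \<in> ring_hom R R" and \<psi>: "\<psi> \<in> ring_hom R R" and S: "S \<subseteq> carrier R"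
    and eq: "\<And>s. s \<in> S \<Longrightarrow> \<phi> s = \<psi> s" and x: "x \<in> generate_field R S"
  shows "\<phi> x = \<psi> x"
proof -
  interpret \<phi>: ring_hom_ring R R \<phi>
    using \<phi> ring_axioms by (simp add: ring_hom_ring_def ring_hom_ring_axioms_def)
  interpret \<psi>: ring_hom_ring R R \<psi>
    using \<psi> ring_axioms by (simp add: ring_hom_ring_def ring_hom_ring_axioms_def)
  note cl = generate_field_in_carrier[OF S]
  show ?thesis
    using x
  proof induction
    case (m_inv h)
    have h: "h \<in> carrier R" "inv h \<in> carrier R" "inv h \<otimes> h = \<one>"
      using cl[OF m_inv.hyps(1)] m_inv.hyps(2) field_Units by auto
    have "\<phi> (inv h) \<otimes> \<phi> h = \<one>"
      using \<phi>.hom_mult[OF h(2,1)] h(3) by (metis \<phi>.hom_one)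
    moreover have "\<psi> (inv h) \<otimes> \<phi> h = \<one>"
      using \<psi>.hom_mult[OF h(2,1)] h(3) m_inv.IH by (metis \<psi>.hom_one)
    ultimately show ?case
      using h by (metis \<phi>.hom_closed \<psi>.hom_closed inv_unique m_comm)
  qed (use cl eq in simp_all)
qed

lemma eval_endo:
  assumes \<phi>: "\<phi> \<in> ring_hom R R" and p: "set p \<subseteq> carrier R" "\<And>a. a \<in> set p \<Longrightarrow> \<phi> a = a"
    and x: "x \<in> carrier R"
  shows "\<phi> (eval p x) = eval p (\<phi> x)"
proof -
  interpret \<phi>: ring_hom_ring R R \<phi>
    using \<phi> ring_axioms by (simp add: ring_hom_ring_def ring_hom_ring_axioms_def)
  have "map \<phi> p = p"
    using p(2) by (simp add: map_idI)
  then show ?thesis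
    using \<phi>.eval_hom'[OF x p(1)] by simp
qed

text \<open>Each element is algebraic over the prime field \<open>generate_field R {}\<close>, which
  endomorphisms fix pointwise. Hence each generator can only go to one of finitely many roots, and
  its values on \<open>S\<close> determine an endomorphism. Restriction discards the arbitrary
  values outside the carrier.\<close>

lemma finite_endos:
  assumes S: "finite S" "S \<subseteq> carrier R" "generate_field R S = carrier R"
    and fin: "finite_dimension (generate_field R {}) (carrier R)"
  shows "finite ((\<lambda>\<phi>. restrict \<phi> (carrier R)) ` ring_hom R R)"
proof -
  define P where "P = generate_field R {}"
  have P: "subfield P R" "P \<subseteq> carrier R"
    unfolding P_def by (simp_all add: generate_field_is_subfield generate_field_incl)
  have fix_P: "\<phi> a = a" if "\<phi> \<in> ring_hom R R" "a \<in> P" for \<phi> a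
    using endos_agree_on_generate_field[OF that(1) id_ring_hom, of "{}" a] that(2)
    by (simp add: P_def)
  have "\<exists>p. p \<in> carrier (P[X]) \<and> p \<noteq> [] \<and> eval p s = \<zero>" if "s \<in> carrier R" for s
    using finite_dimension_imp_algebraic[OF P(1) carrier_is_subring] fin that
      algebraicE[OF subfieldE(1)[OF P(1)] that] unfolding P_def by metis
  then obtain p where p: "\<And>s. s \<in> carrier R \<Longrightarrow> p s \<in> carrier (P[X]) \<and> p s \<noteq> [] \<and> eval (p s) s = \<zero>"
    by metis
  define V where "V s = {x. is_root (p s) x}" for s
  have V: "finite (V s)" if "s \<in> S" for s
    unfolding V_def using finite_number_of_roots carrier_polynomial_shell[OF subfieldE(1)[OF P(1)]] p that S(2)
    by blast
  have root: "\<phi> s \<in> V s" if "\<phi> \<in> ring_hom R R" "s \<in> S" for \<phi> s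
  proof -
    have s: "s \<in> carrier R"
      using that S(2) by blast
    have "set (p s) \<subseteq> P"
      using p[OF s] polynomial_incl univ_poly_carrier by metis
    then have "\<phi> (eval (p s) s) = eval (p s) (\<phi> s)"
      using P(2) fix_P[OF that(1)] s by (intro eval_endo[OF that(1)]) auto
    moreover have "\<phi> \<zero> = \<zero>"
      using ring_hom_zero[OF that(1) ring_axioms ring_axioms] .
    ultimately show ?thesis
      using p[OF s] ring_hom_closed[OF that(1) s] by (simp add: V_def is_root_def)
  qed
  show ?thesis
  proof (rule inj_on_finite)
    show "inj_on (\<lambda>f. restrict f S) ((\<lambda>\<phi>. restrict \<phi> (carrier R)) ` ring_hom R R)"
    proof (rule inj_onI, clarify)
      fix \<phi> \<psi> assume h: "\<phi> \<in> ring_hom R R" "\<psi> \<in> ring_hom R R"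
        and eq: "restrict (restrict \<phi> (carrier R)) S = restrict (restrict \<psi> (carrier R)) S"
      have "\<phi> s = \<psi> s" if "s \<in> S" for s
        using fun_cong[OF eq, of s] that S(2) by auto
      then have "\<phi> x = \<psi> x" if "x \<in> carrier R" for x
        using endos_agree_on_generate_field[OF h S(2)] S(3) that by blast
      then show "restrict \<phi> (carrier R) = restrict \<psi> (carrier R)"
        by (auto simp: restrict_def)
    qed
    show "(\<lambda>f. restrict f S) ` (\<lambda>\<phi>. restrict \<phi> (carrier R)) ` ring_hom R R \<subseteq> Pi\<^sub>E S V"
      using root S(2) by (auto simp: subset_iff)
    show "finite (Pi\<^sub>E S V)"
      using S(1) V by (rule finite_PiE)
  qed
qed

text \<open>The multiplicative group is cyclic, and an endomorphism is determined by the image of a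
  generator, which is nonzero.\<close>

lemma card_endos_less:
  assumes fin: "finite (carrier R)"
  shows "card ((\<lambda>\<phi>. restrict \<phi> (carrier R)) ` ring_hom R R) < card (carrier R)"
proof -
  obtain g where g: "g \<in> carrier (Multiplicative_Group.mult_of R)" "carrier (Multiplicative_Group.mult_of R) = {g[^]i | i::nat. i \<in> UNIV}"
    using finite_field_mult_group_has_gen[OF fin] by (rule bexE)
  have gR: "g \<in> carrier R" "g \<noteq> \<zero>"
    using g(1) by simp_all
  have "card ((\<lambda>\<phi>. restrict \<phi> (carrier R)) ` ring_hom R R) \<le> card (carrier R - {\<zero>})"
  proof (rule card_inj_on_le)
    show "finite (carrier R - {\<zero>})"
      using fin by simp
    show "(\<lambda>f. f g) ` (\<lambda>\<phi>. restrict \<phi> (carrier R)) ` ring_hom R R \<subseteq> carrier R - {\<zero>}"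
    proof clarify
      fix \<phi> assume \<phi>: "\<phi> \<in> ring_hom R R"
      interpret \<phi>: ring_hom_ring R R \<phi>
        using \<phi> ring_axioms by (simp add: ring_hom_ring_def ring_hom_ring_axioms_def)
      have "\<phi> g \<noteq> \<zero>"
      proof
        assume "\<phi> g = \<zero>"
        moreover have "inv g \<in> carrier R" "inv g \<otimes> g = \<one>"
          using gR field_Units by auto
        ultimately show False
          using \<phi>.hom_mult[of "inv g" g] gR by simp
      qed
      then show "restrict \<phi> (carrier R) g \<in> carrier R - {\<zero>}"
        using gR by simp
    qed
    show "inj_on (\<lambda>f. f g) ((\<lambda>\<phi>. restrict \<phi> (carrier R)) ` ring_hom R R)"
    proof (rule inj_onI, clarify)
      fix \<phi> \<psi> assume h: "\<phi> \<in> ring_hom R R" "\<psi> \<in> ring_hom R R"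
        and "restrict \<phi> (carrier R) g = restrict \<psi> (carrier R) g"
      then have eq: "\<phi> g = \<psi> g"
        using gR by simp
      interpret \<phi>: ring_hom_ring R R \<phi>
        using h ring_axioms by (simp add: ring_hom_ring_def ring_hom_ring_axioms_def)
      interpret \<psi>: ring_hom_ring R R \<psi>
        using h ring_axioms by (simp add: ring_hom_ring_def ring_hom_ring_axioms_def)
      have pow: "\<phi> (g [^] i) = \<psi> (g [^] i)" for i :: nat
        by (induction i) (simp_all add: eq gR)
      have "\<phi> x = \<psi> x" if "x \<in> carrier R" for x
      proof (cases "x = \<zero>")
        case False
        then have "x \<in> carrier (Multiplicative_Group.mult_of R)"
          using that by simp
        then obtain i :: nat where "x = g [^] i"
          using g(2) by blast
        then show ?thesis
          using pow by simp
      qed simp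
      then show "restrict \<phi> (carrier R) = restrict \<psi> (carrier R)"
        by (auto simp: restrict_def)
    qed
  qed
  also have "\<dots> < card (carrier R)"
    using fin by (intro psubset_card_mono) auto
  finally show ?thesis .
qed

text \<open>By Zorn's lemma there is a maximal subspace above \<open>V\<close> avoiding
  \<open>x\<close>. Maximality makes it a complement of the line spanned by \<open>x\<close>:
  adjoining any further \<open>y\<close> captures \<open>x\<close>, and the resulting relation can
  be solved for \<open>y\<close>.\<close>

lemma exists_complement_subspace:
  assumes P: "subfield P R" and V: "subalgebra P V R" and x: "x \<in> carrier R" "x \<notin> V"
  obtains W where "subalgebra P W R" "V \<subseteq> W" "x \<notin> W"
    "\<And>y. y \<in> carrier R \<Longrightarrow> \<exists>k\<in>P. y \<ominus> k \<otimes> x \<in> W"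
proof -
  define A where "A = {W. subalgebra P W R \<and> V \<subseteq> W \<and> x \<notin> W}"
  have "\<exists>M\<in>A. \<forall>Z\<in>A. M \<subseteq> Z \<longrightarrow> Z = M"
  proof (rule subset_Zorn_nonempty)
    show "A \<noteq> {}"
      using V x by (auto simp: A_def)
    fix C assume C: "C \<noteq> {}" "subset.chain A C"
    have mem: "subalgebra P W R" "V \<subseteq> W" "x \<notin> W" if "W \<in> C" for W
      using C(2) that by (auto simp: subset.chain_def A_def)
    have chain: "W \<subseteq> W' \<or> W' \<subseteq> W" if "W \<in> C" "W' \<in> C" for W W'
      using C(2) that by (auto simp: subset_chain_def)
    have two: "\<exists>W\<in>C. u \<in> W \<and> v \<in> W" if uv: "u \<in> \<Union>C" "v \<in> \<Union>C" for u v
    proof -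
      obtain W W' where "W \<in> C" "u \<in> W" "W' \<in> C" "v \<in> W'"
        using uv by (elim UnionE)
      then show ?thesis
        using chain[of W W'] by (meson subsetD)
    qed
    have sub: "subgroup W (add_monoid R)" if "W \<in> C" for W
      using mem(1)[OF that] by (simp add: subalgebra_def)
    have "subgroup (\<Union>C) (add_monoid R)"
    proof (rule add.subgroupI)
      show "\<Union>C \<subseteq> carrier R"
        using subalgebra_in_carrier mem(1) by blast
      show "\<Union>C \<noteq> {}"
        using C(1) subgroup.one_closed[OF sub] by fastforce
      fix u v assume uv: "u \<in> \<Union>C" "v \<in> \<Union>C"
      then obtain W where W: "W \<in> C" "u \<in> W" "v \<in> W"
        using two by blast
      show "\<ominus> u \<in> \<Union>C"
        by (rule UnionI[OF W(1) add.subgroupE(3)[OF sub[OF W(1)] W(2)]])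
      show "u \<oplus> v \<in> \<Union>C"
        by (rule UnionI[OF W(1) add.subgroupE(4)[OF sub[OF W(1)] W(2,3)]])
    qed
    then have "subalgebra P (\<Union>C) R"
      using subalgebra.smult_closed[OF mem(1)] by (auto simp: subalgebra_def subalgebra_axioms_def)
    moreover have "V \<subseteq> \<Union>C"
      using C(1) mem(2) by blast
    moreover have "x \<notin> \<Union>C"
      using mem(3) by blast
    ultimately show "\<Union>C \<in> A"
      by (simp add: A_def)
  qed
  then obtain W where W: "subalgebra P W R" "V \<subseteq> W" "x \<notin> W"
    and max: "\<And>Z. subalgebra P Z R \<Longrightarrow> V \<subseteq> Z \<Longrightarrow> x \<notin> Z \<Longrightarrow> W \<subseteq> Z \<Longrightarrow> Z = W"
    by (auto simp: A_def)
  have W_group: "subgroup W (add_monoid R)" and W_carrier: "W \<subseteq> carrier R"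
    using W(1) subalgebra_in_carrier by (auto simp: subalgebra_def)
  note smult = subalgebra.smult_closed[OF W(1)]
  have P_carrier: "P \<subseteq> carrier R"
    using subring_props(1)[OF P] .
  have "\<exists>k\<in>P. y \<ominus> k \<otimes> x \<in> W" if y: "y \<in> carrier R" for y
  proof (cases "y \<in> W")
    case True
    then show ?thesis
      using x y subring_props(2)[OF P] by (intro bexI[of _ \<zero>]) (simp_all add: a_minus_def)
  next
    case False
    let ?L = "line_extension P y W"
    have "y = \<one> \<otimes> y \<oplus> \<zero>"
      using y by simp
    then have yL: "y \<in> ?L"
      using line_extension_mem_iff subring_props(3)[OF P] subgroup.one_closed[OF W_group] by auto
    have WL: "W \<subseteq> ?L"
    proof
      fix w assume w: "w \<in> W"
      then have "w = \<zero> \<otimes> y \<oplus> w"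
        using y W_carrier by auto
      then show "w \<in> ?L"
        using w line_extension_mem_iff subring_props(2)[OF P] by auto
    qed
    have "subalgebra P ?L R"
      using line_extension_is_subgroup[OF P W_group y] line_extension_smult_closed[OF P smult W_carrier y]
      by (simp add: subalgebra_def subalgebra_axioms_def)
    then have "x \<in> ?L"
      using max[of ?L] WL W(2) yL False by blast
    then obtain k w where kw: "k \<in> P" "w \<in> W" "x = k \<otimes> y \<oplus> w"
      using line_extension_mem_iff by blast
    have "k \<noteq> \<zero>"
      using kw W(3) W_carrier y by auto
    then have i: "inv k \<in> P" "inv k \<otimes> k = \<one>"
      using subfield_m_inv[OF P, of k] kw(1) by auto
    have kc: "k \<in> carrier R" "inv k \<in> carrier R" "w \<in> carrier R"
      using i kw P_carrier W_carrier by auto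
    have "y \<ominus> inv k \<otimes> x = (\<one> \<ominus> inv k \<otimes> k) \<otimes> y \<oplus> \<ominus> (inv k \<otimes> w)"
      unfolding kw(3) using y kc by algebra
    also have "\<dots> = \<ominus> (inv k \<otimes> w)"
      using y kc by (simp add: i(2) a_minus_def r_neg)
    also have "\<dots> \<in> W"
      using smult[OF i(1) kw(2)] add.subgroupE(3)[OF W_group] by blast
    finally show ?thesis
      using i(1) by blast
  qed
  then show thesis
    using that W by blast
qed

text \<open>Infinite dimension leaves some \<open>x\<close> outside the span of \<open>U\<close>.
  The map \<open>f\<close> is the coordinate along \<open>x\<close> with respect to a complement
  \<open>W\<close> of its line containing that span, so it vanishes on \<open>U\<close> and is one
  at \<open>x\<close>.\<close>

lemma exists_additive_map:
  assumes P: "subfield P R" and inf: "\<not> finite_dimension P (carrier R)"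
    and U: "finite U" "U \<subseteq> carrier R"
  obtains f x where "\<And>y. y \<in> carrier R \<Longrightarrow> f y \<in> carrier R"
    "\<And>y z. y \<in> carrier R \<Longrightarrow> z \<in> carrier R \<Longrightarrow> f (y \<oplus> z) = f y \<oplus> f z"
    "\<And>u. u \<in> U \<Longrightarrow> f u = \<zero>" "x \<in> carrier R" "f x \<noteq> \<zero>"
proof -
  obtain Us where Us: "set Us = U"
    using finite_list[OF U(1)] by blast
  have UsC: "set Us \<subseteq> carrier R"
    using Us U(2) by simp
  have "Span P Us \<noteq> carrier R"
    using Span_finite_dimension[OF P UsC] inf by metis
  moreover have "Span P Us \<subseteq> carrier R"
    using Span_subgroup_props(1)[OF P UsC] .
  ultimately obtain x where x: "x \<in> carrier R" "x \<notin> Span P Us"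
    by blast
  obtain W where W: "subalgebra P W R" "Span P Us \<subseteq> W" "x \<notin> W"
    and compl: "\<And>y. y \<in> carrier R \<Longrightarrow> \<exists>k\<in>P. y \<ominus> k \<otimes> x \<in> W"
    using exists_complement_subspace[OF P Span_is_subalgebra[OF P UsC] x] by metis
  obtain f where f: "\<And>y. y \<in> carrier R \<Longrightarrow> f y \<in> P \<and> y \<ominus> f y \<otimes> x \<in> W"
    using compl by metis
  have W_group: "subgroup W (add_monoid R)" and W_carrier: "W \<subseteq> carrier R"
    using W(1) subalgebra_in_carrier by (auto simp: subalgebra_def)
  note smult = subalgebra.smult_closed[OF W(1)]
  have P_carrier: "P \<subseteq> carrier R"
    using subring_props(1)[OF P] .
  have minus_W: "u \<ominus> v \<in> W" if "u \<in> W" "v \<in> W" for u v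
    using that add.subgroupE(3,4)[OF W_group] by (simp add: a_minus_def)
  \<comment> \<open>Two different coefficients for \<open>y\<close> would put a nonzero multiple of
    \<open>x\<close>, and hence \<open>x\<close> itself, into \<open>W\<close>. Additivity and the
    values of \<open>f\<close> all follow from this uniqueness.\<close>
  have unique: "k = f y" if "k \<in> P" "y \<in> carrier R" "y \<ominus> k \<otimes> x \<in> W" for k y
  proof (rule ccontr)
    assume ne: "k \<noteq> f y"
    have c: "k \<in> carrier R" "f y \<in> carrier R"
      using that f[OF that(2)] P_carrier by auto
    define d where "d = f y \<ominus> k"
    have d: "d \<in> P" "d \<noteq> \<zero>"
    proof -
      show "d \<in> P"
        using that f[OF that(2)] subring_props(5,7)[OF P] by (simp add: d_def a_minus_def)
      show "d \<noteq> \<zero>"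
        using c ne by (simp add: d_def)
    qed
    have dc: "d \<in> carrier R" "inv d \<in> P" "inv d \<otimes> d = \<one>"
      using d P_carrier subfield_m_inv[OF P, of d] by auto
    have "d \<otimes> x = (y \<ominus> k \<otimes> x) \<ominus> (y \<ominus> f y \<otimes> x)"
      unfolding d_def using x that(2) c by algebra
    then have "d \<otimes> x \<in> W"
      using minus_W[OF that(3)] f[OF that(2)] by simp
    then have "inv d \<otimes> (d \<otimes> x) \<in> W"
      using smult dc by blast
    then show False
      using W(3) dc x P_carrier by (simp add: m_assoc[symmetric] subset_iff)
  qed
  show thesis
  proof (rule that[of f x])
    show "f y \<in> carrier R" if "y \<in> carrier R" for y
      using f[OF that] P_carrier by blast
    show "f (y \<oplus> z) = f y \<oplus> f z" if yz: "y \<in> carrier R" "z \<in> carrier R" for y z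
    proof -
      have c: "f y \<in> carrier R" "f z \<in> carrier R"
        using f yz P_carrier by auto
      have "(y \<oplus> z) \<ominus> (f y \<oplus> f z) \<otimes> x = (y \<ominus> f y \<otimes> x) \<oplus> (z \<ominus> f z \<otimes> x)"
        using x yz c by algebra
      then have "(y \<oplus> z) \<ominus> (f y \<oplus> f z) \<otimes> x \<in> W"
        using f yz add.subgroupE(4)[OF W_group] by simp
      then show ?thesis
        using unique[of "f y \<oplus> f z" "y \<oplus> z"] f yz subring_props(7)[OF P] by auto
    qed
    show "f u = \<zero>" if "u \<in> U" for u
    proof -
      have u: "u \<in> W" "u \<in> carrier R"
        using Span_base_incl[OF P UsC] W(2) that Us U(2) by auto
      then have "u \<ominus> \<zero> \<otimes> x \<in> W"
        using x by (simp add: a_minus_def)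
      then show ?thesis
        using unique[of \<zero> u] u subring_props(2)[OF P] by simp
    qed
    show "x \<in> carrier R"
      by (rule x)
    have "\<zero> \<in> W"
      using subgroup.one_closed[OF W_group] by simp
    moreover have "x \<ominus> \<one> \<otimes> x = \<zero>"
      using x by simp
    ultimately have "x \<ominus> \<one> \<otimes> x \<in> W"
      by metis
    then have "\<one> = f x"
      by (rule unique[OF subring_props(3)[OF P] x(1)])
    then show "f x \<noteq> \<zero>"
      using one_not_zero by simp
  qed
qed

end

section \<open>Exclusion of finitely generated fields\<close>

context heisenberg_bi
begin

lemma shear_mult_auto:
  "c \<in> carrier R \<Longrightarrow> hmap R (shear R ((\<otimes>) c)) \<in> autos (group_structure H)"
  by (rule shear_auto) (simp_all add: r_distr)

text \<open>Shears by different multiplications differ at (1, 0, 0), so by faithfulness the field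
  has at least as many endomorphisms as elements. Finiteness of their number makes the field finite,
  where there are too few.\<close>

lemma not_finite_dimensional:
  assumes S: "finite S" "S \<subseteq> carrier R" "generate_field R S = carrier R"
  shows "\<not> finite_dimension (generate_field R {}) (carrier R)"
proof
  assume fd: "finite_dimension (generate_field R {}) (carrier R)"
  let ?E = "(\<lambda>\<phi>. restrict \<phi> (carrier R)) ` ring_hom R R"
  let ?s = "\<lambda>c. hmap R (shear R ((\<otimes>) c))"
  let ?f = "\<lambda>c. restrict (\<Phi> (?s c)) (carrier R)"
  have fin: "finite ?E"
    by (rule finite_endos[OF S fd])
  have inj: "inj_on ?f (carrier R)"
  proof (rule inj_onI)
    fix c d assume cd: "c \<in> carrier R" "d \<in> carrier R" "?f c = ?f d"
    have "\<Phi> (?s c) m = \<Phi> (?s d) m" if "m \<in> carrier R" for m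
      using fun_cong[OF cd(3), of m] that by simp
    moreover have t: "(\<one>, \<zero>, \<zero>) \<in> triples R"
      by (simp add: triples_def)
    ultimately have "?s c (hmat R (\<one>, \<zero>, \<zero>)) = ?s d (hmat R (\<one>, \<zero>, \<zero>))"
      using \<Phi>_inj[OF shear_mult_auto[OF cd(1)] shear_mult_auto[OF cd(2)]] hmat_carrier[OF t] by blast
    then have "hmat R (\<one>, \<zero>, c) = hmat R (\<one>, \<zero>, d)"
      using cd by (simp add: hmap_def hcoords_hmat shear_def)
    then show "c = d"
      by (metis hcoords_hmat prod.inject)
  qed
  have sub: "?f ` carrier R \<subseteq> ?E"
    using \<Phi>_hom[OF shear_mult_auto] by blast
  have "finite (carrier R)"
    using inj_on_finite[OF inj sub fin] .
  then show False
    using card_inj_on_le[OF inj sub fin] card_endos_less by simp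
qed

lemma not_finitely_generated: "\<not> finitely_generated_field R"
proof
  assume "finitely_generated_field R"
  then obtain S where S: "finite S" "S \<subseteq> carrier R" "generate_field R S = carrier R"
    by (auto simp: finitely_generated_field_def)
  obtain T where T: "finite T" "T \<subseteq> carrier H"
    "\<And>\<beta>. \<beta> \<in> autos (group_structure H) \<Longrightarrow> \<forall>t\<in>T. \<beta> t = t \<Longrightarrow> \<forall>s\<in>S. \<Phi> \<beta> s = s"
    using \<Phi>_fixes[OF S(1,2)] by metis
  \<comment> \<open>A shear by \<open>f\<close> changes a matrix only by adding the value of
    \<open>f\<close> at its (1, 2) entry to the corner, so vanishing of \<open>f\<close> on these
    entries fixes \<open>T\<close>.\<close>
  define U where "U = (\<lambda>A. A $ 1 $ 2) ` T"
  have U: "finite U" "U \<subseteq> carrier R"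
    using T(1,2) by (auto simp: U_def heisenberg_def)
  have P: "subfield (generate_field R {}) R"
    by (simp add: generate_field_is_subfield)
  obtain f x where f: "\<And>y. y \<in> carrier R \<Longrightarrow> f y \<in> carrier R"
    "\<And>y z. y \<in> carrier R \<Longrightarrow> z \<in> carrier R \<Longrightarrow> f (y \<oplus> z) = f y \<oplus> f z"
    "\<And>u. u \<in> U \<Longrightarrow> f u = \<zero>" and x: "x \<in> carrier R" "f x \<noteq> \<zero>"
    by (rule exists_additive_map[OF P not_finite_dimensional[OF S] U]) (rule that, assumption+)
  let ?\<beta> = "hmap R (shear R f)"
  have \<beta>: "?\<beta> \<in> autos (group_structure H)"
    by (rule shear_auto[OF f(1,2)])
  have "?\<beta> A = A" if "A \<in> T" for A
  proof -
    have A: "A \<in> carrier H"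
      using that T(2) by blast
    have "f (A $ 1 $ 2) = \<zero>"
      using that f(3) by (simp add: U_def)
    moreover have "A $ 1 $ 3 \<in> carrier R"
      using A by (simp add: heisenberg_def)
    ultimately have "shear R f (hcoords A) = hcoords A"
      by (simp add: shear_def hcoords_def)
    then show ?thesis
      using hmat_hcoords[OF A] by (simp add: hmap_def)
  qed
  then have fix_S: "\<Phi> ?\<beta> s = s" if "s \<in> S" for s
    using T(3)[OF \<beta>] that by blast
  \<comment> \<open>The induced endomorphism fixes the generators, hence everything; by faithfulness
    the shear would be trivial, although it moves (x, 0, 0).\<close>
  have "\<Phi> ?\<beta> m = \<Phi> id m" if "m \<in> carrier R" for m
    using endos_agree_on_generate_field[OF \<Phi>_hom[OF \<beta>] id_ring_hom S(2)] fix_S that S(3)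
      \<Phi>_id[OF id_autos] by simp
  moreover have t: "(x, \<zero>, \<zero>) \<in> triples R"
    using x by (simp add: triples_def)
  ultimately have "?\<beta> (hmat R (x, \<zero>, \<zero>)) = id (hmat R (x, \<zero>, \<zero>))"
    using \<Phi>_inj[OF \<beta> id_autos] hmat_carrier[OF t] by blast
  then have "hmat R (x, \<zero>, f x) = hmat R (x, \<zero>, \<zero>)"
    using x f(1) by (simp add: hmap_def hcoords_hmat shear_def)
  then show False
    using x(2) by (metis hcoords_hmat prod.inject)
qed

end


section \<open>The \<open>p\<close>-adic absolute value\<close>

text \<open>Built by the same recursion as \<open>numeral_tm\<close>, so that the closed term
  evaluates to it.\<close>

primrec ring_numeral :: "('b, 'n) ring_scheme \<Rightarrow> nat \<Rightarrow> 'b" where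
  "ring_numeral R 0 = \<zero>\<^bsub>R\<^esub>"
| "ring_numeral R (Suc n) = ring_numeral R n \<oplus>\<^bsub>R\<^esub> \<one>\<^bsub>R\<^esub>"

context
  fixes p :: nat assumes p: "Factorial_Ring.prime p"
begin

lemma p_gt_1: "real p > 1"
  using prime_gt_1_nat[OF p] by simp

text \<open>Any fraction may be used, not only the reduced one of \<open>quotient_of\<close>:
  cross-multiplying two fractions and counting factors of \<open>p\<close> gives the same
  exponent.\<close>

lemma padic_abs_quotient:
  assumes "a \<noteq> 0" "b \<noteq> 0"
  shows "padic_abs p (of_int a / of_int b) =
    real p powi (int (multiplicity (int p) b) - int (multiplicity (int p) a))"
proof -
  have pe: "prime_elem (int p)"
    using p by (simp add: prime_imp_prime_elem)
  let ?x = "of_int a / of_int b :: rat"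
  obtain n d where q: "quotient_of ?x = (n, d)"
    by fastforce
  have d: "d > 0" and x: "?x = of_int n / of_int d"
    using quotient_of_denom_pos[OF q] quotient_of_div[OF q] by simp_all
  have n: "n \<noteq> 0"
    using x assms by auto
  have "of_int a * of_int d = (of_int n * of_int b :: rat)"
    using x assms d by (simp add: field_simps)
  then have "a * d = n * b"
    by (metis of_int_eq_iff of_int_mult)
  then have "multiplicity (int p) (a * d) = multiplicity (int p) (n * b)"
    by simp
  then have "multiplicity (int p) a + multiplicity (int p) d = multiplicity (int p) n + multiplicity (int p) b"
    using assms d n by (simp add: prime_elem_multiplicity_mult_distrib[OF pe])
  then have "int (multiplicity (int p) d) - int (multiplicity (int p) n)
      = int (multiplicity (int p) b) - int (multiplicity (int p) a)"
    by linarith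
  then show ?thesis
    using assms by (simp add: padic_abs_def q)
qed

lemma rat_quotientE:
  fixes x :: rat
  obtains a b where "b \<noteq> 0" "x = of_int a / of_int b"
  by (metis quotient_of_denom_pos quotient_of_div less_irrefl surj_pair)

lemma padic_abs_0 [simp]: "padic_abs p 0 = 0"
  by (simp add: padic_abs_def)

lemma padic_abs_pos: "x \<noteq> 0 \<Longrightarrow> padic_abs p x > 0"
  using p_gt_1 by (simp add: padic_abs_def)

lemma padic_abs_nonneg [simp]: "padic_abs p x \<ge> 0"
  using padic_abs_pos[of x] by (cases "x = 0") auto

lemma padic_abs_eq_0_iff [simp]: "padic_abs p x = 0 \<longleftrightarrow> x = 0"
  using padic_abs_pos[of x] by (cases "x = 0") auto

lemma padic_abs_1 [simp]: "padic_abs p 1 = 1"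
  using padic_abs_quotient[of 1 1] by simp

lemma padic_abs_mult: "padic_abs p (x * y) = padic_abs p x * padic_abs p y"
proof (cases "x = 0 \<or> y = 0")
  case False
  have pe: "prime_elem (int p)"
    using p by (simp add: prime_imp_prime_elem)
  obtain a b c d where q: "b \<noteq> 0" "x = of_int a / of_int b" "d \<noteq> 0" "y = of_int c / of_int d"
    by (metis rat_quotientE)
  have nz: "a \<noteq> 0" "c \<noteq> 0"
    using False q by auto
  have "x * y = of_int (a * c) / of_int (b * d)"
    using q by simp
  then have "padic_abs p (x * y)
      = real p powi (int (multiplicity (int p) (b * d)) - int (multiplicity (int p) (a * c)))"
    using padic_abs_quotient[of "a * c" "b * d"] nz q by simp
  also have "\<dots> = real p powi ((int (multiplicity (int p) b) - int (multiplicity (int p) a))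
      + (int (multiplicity (int p) d) - int (multiplicity (int p) c)))"
    using nz q by (simp add: prime_elem_multiplicity_mult_distrib[OF pe] algebra_simps)
  also have "\<dots> = padic_abs p x * padic_abs p y"
    using padic_abs_quotient[of a b] padic_abs_quotient[of c d] nz q p_gt_1
    by (simp add: power_int_add)
  finally show ?thesis .
qed auto

lemma padic_abs_minus [simp]: "padic_abs p (- x) = padic_abs p x"
proof -
  have "padic_abs p (-1) * padic_abs p (-1) = 1"
    using padic_abs_mult[of "-1" "-1"] by simp
  then have "padic_abs p (-1) = 1"
    by (metis padic_abs_nonneg power2_eq_1_iff power2_eq_square neg_0_le_iff_le not_one_le_zero)
  then show ?thesis
    using padic_abs_mult[of "-1" x] by simp
qed

lemma padic_abs_minus_commute: "padic_abs p (x - y) = padic_abs p (y - x)"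
  using padic_abs_minus[of "x - y"] by simp

lemma padic_abs_divide: "padic_abs p (x / y) = padic_abs p x / padic_abs p y"
proof (cases "y = 0")
  case False
  then have "padic_abs p (x / y) * padic_abs p y = padic_abs p x"
    using padic_abs_mult[of "x / y" y] by simp
  then show ?thesis
    using False by (simp add: field_simps)
qed simp

text \<open>Over a common denominator, the smaller of the two powers of \<open>p\<close> dividing
  the numerators also divides their sum.\<close>

lemma padic_abs_add: "padic_abs p (x + y) \<le> max (padic_abs p x) (padic_abs p y)"
proof (cases "x = 0 \<or> y = 0 \<or> x + y = 0")
  case True
  then show ?thesis
    by (auto simp: max_def)
next
  case False
  have np: "\<not> is_unit (int p)"
    using prime_gt_1_nat[OF p] by simp
  obtain a b c d where q: "b \<noteq> 0" "x = of_int a / of_int b" "d \<noteq> 0" "y = of_int c / of_int d"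
    by (metis rat_quotientE)
  define m where "m = b * d"
  have m: "m \<noteq> 0"
    using q by (simp add: m_def)
  have x: "x = of_int (a * d) / of_int m" and y: "y = of_int (c * b) / of_int m"
    using q by (simp_all add: m_def)
  have xy: "x + y = of_int (a * d + c * b) / of_int m"
    unfolding x y by (simp add: add_divide_distrib)
  have nz: "a * d \<noteq> 0" "c * b \<noteq> 0" "a * d + c * b \<noteq> 0"
    using False x y xy by (metis divide_eq_0_iff of_int_0)+
  define k where "k = min (multiplicity (int p) (a * d)) (multiplicity (int p) (c * b))"
  have "int p ^ k dvd a * d" "int p ^ k dvd c * b"
    by (simp_all add: k_def multiplicity_dvd')
  then have "int p ^ k dvd a * d + c * b"
    by (rule dvd_add)
  then have k: "k \<le> multiplicity (int p) (a * d + c * b)"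
    using nz(3) np by (intro multiplicity_geI) auto
  let ?e = "\<lambda>z. int (multiplicity (int p) m) - int (multiplicity (int p) z)"
  have "?e (a * d + c * b) \<le> max (?e (a * d)) (?e (c * b))"
    using k unfolding k_def by linarith
  then have "real p powi ?e (a * d + c * b) \<le> real p powi (max (?e (a * d)) (?e (c * b)))"
    using p_gt_1 by (intro power_int_increasing) auto
  also have "\<dots> \<le> max (real p powi ?e (a * d)) (real p powi ?e (c * b))"
    by (simp add: max_def)
  finally show ?thesis
    unfolding xy unfolding x y using padic_abs_quotient[OF nz(1) m] padic_abs_quotient[OF nz(2) m]
      padic_abs_quotient[OF nz(3) m] by simp
qed

lemma padic_abs_add_le: "padic_abs p x \<le> c \<Longrightarrow> padic_abs p y \<le> c \<Longrightarrow> padic_abs p (x + y) \<le> c"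
  using padic_abs_add[of x y] by linarith

lemma padic_abs_add_less: "padic_abs p x < c \<Longrightarrow> padic_abs p y < c \<Longrightarrow> padic_abs p (x + y) < c"
  using padic_abs_add[of x y] by linarith

lemma padic_abs_diff_less: "padic_abs p x < c \<Longrightarrow> padic_abs p y < c \<Longrightarrow> padic_abs p (x - y) < c"
  using padic_abs_add_less[of x c "- y"] by simp

text \<open>The ultrametric inequality turned into a lower bound: a perturbation smaller than
  \<open>x\<close> cannot decrease its absolute value.\<close>

lemma padic_abs_dominant:
  assumes "padic_abs p (x - y) < padic_abs p x"
  shows "padic_abs p x \<le> padic_abs p y"
  using padic_abs_add[of "x - y" y] assms by simp

lemma padic_abs_of_int: "a \<noteq> 0 \<Longrightarrow> padic_abs p (of_int a) = (1 / real p) ^ multiplicity (int p) a"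
  using padic_abs_quotient[of a 1] by (simp add: power_int_minus power_one_over field_simps)

lemma padic_abs_of_int_dvd:
  assumes "int p ^ k dvd a"
  shows "padic_abs p (of_int a) \<le> (1 / real p) ^ k"
proof (cases "a = 0")
  case False
  then have "k \<le> multiplicity (int p) a"
    using assms prime_gt_1_nat[OF p] by (intro multiplicity_geI) auto
  then show ?thesis
    using padic_abs_of_int[OF False] p_gt_1 by (simp add: power_decreasing)
qed (use p_gt_1 in auto)

text \<open>The square of \<open>p\<close> is at least 4 and cannot divide 2. This bound allows
  \<open>p = 2\<close> to be treated together with the odd primes.\<close>

lemma padic_abs_2: "padic_abs p 2 \<ge> 1 / real p"
proof -
  have "multiplicity (int p) 2 \<le> 1"
  proof (rule ccontr)
    assume "\<not> ?thesis"
    then have "int p ^ 2 dvd 2"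
      by (intro multiplicity_dvd') auto
    then have "int p ^ 2 \<le> 2"
      by (rule zdvd_imp_le) simp
    moreover have "int 2 ^ 2 \<le> int p ^ 2"
      using prime_ge_2_nat[OF p] by (intro power_mono) auto
    ultimately show False by simp
  qed
  then have "(1 / real p) ^ 1 \<le> (1 / real p) ^ multiplicity (int p) 2"
    using p_gt_1 by (intro power_decreasing) auto
  then show ?thesis
    using padic_abs_of_int[of 2] by simp
qed


section \<open>Square classes of \<open>p\<close>-adic numbers\<close>

text \<open>Writing a/b as a b / b^2 and removing an even power of \<open>p\<close> leaves an
  integer \<open>A\<close> divisible by \<open>p\<close> at most once. Its residue \<open>r\<close>
  modulo \<open>p ^ 4\<close> has absolute value at least 1/p, so the quotient of \<open>A\<close>
  by \<open>r\<close> lies within p^-3 of one.\<close>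

lemma rat_square_class:
  fixes q :: rat
  assumes "q \<noteq> 0"
  obtains r c e where "r \<le> p ^ 4" "q = of_nat r * (c * c) * e" "padic_abs p (e - 1) \<le> (1 / real p) ^ 3"
proof -
  have np: "\<not> is_unit (int p)"
    using prime_gt_1_nat[OF p] by simp
  have ip: "0 < 1 / real p" "1 / real p < 1"
    using p_gt_1 by simp_all
  obtain a b where q: "b \<noteq> 0" "q = of_int a / of_int b"
    by (rule rat_quotientE)
  have nz: "a * b \<noteq> 0"
    using q assms by auto
  define j where "j = multiplicity (int p) (a * b)"
  obtain m where m: "a * b = int p ^ j * m" "\<not> int p dvd m"
    using multiplicity_decompose'[OF nz np] j_def by metis
  define A where "A = int p ^ (j mod 2) * m"
  have j: "int p ^ j = int p ^ (j mod 2) * (int p ^ (j div 2) * int p ^ (j div 2))"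
    by (simp add: power_add[symmetric]) (metis add.commute mult_2 mult_div_mod_eq)
  define c where "c = of_int (int p ^ (j div 2)) / (of_int b :: rat)"
  have "q = of_int (a * b) / (of_int b * of_int b)"
    using q by simp
  also have "a * b = A * (int p ^ (j div 2) * int p ^ (j div 2))"
    using m(1) j by (simp add: A_def)
  finally have qA: "q = of_int A * (c * c)"
    by (simp add: c_def)
  have pe: "prime_elem (int p)"
    using p by (simp add: prime_imp_prime_elem)
  have "m \<noteq> 0" "multiplicity (int p) m = 0"
    using m(2) by (auto simp: not_dvd_imp_multiplicity_0)
  then have "multiplicity (int p) A = j mod 2" "A \<noteq> 0"
    using np p_gt_1 by (simp_all add: A_def prime_elem_multiplicity_mult_distrib[OF pe] multiplicity_same_power)
  then have "padic_abs p (of_int A) = (1 / real p) ^ (j mod 2)"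
    by (simp add: padic_abs_of_int)
  moreover have "(1 / real p) ^ 1 \<le> (1 / real p) ^ (j mod 2)"
    using ip by (intro power_decreasing) auto
  ultimately have absA: "padic_abs p (of_int A) \<ge> 1 / real p"
    by simp
  define r where "r = nat (A mod int p ^ 4)"
  have p4: "int p ^ 4 > 0"
    using prime_gt_0_nat[OF p] by simp
  have r: "int r = A mod int p ^ 4"
    using p4 by (simp add: r_def)
  have "int r \<le> int p ^ 4"
    using r p4 by (simp add: less_imp_le)
  then have r_le: "r \<le> p ^ 4"
    by (metis of_nat_le_iff of_nat_power)
  have "int p ^ 4 dvd A - int r"
    by (simp add: r mod_eq_dvd_iff[symmetric])
  then have Ar: "padic_abs p (of_int (A - int r)) \<le> (1 / real p) ^ 4"
    by (rule padic_abs_of_int_dvd)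
  have "(1 / real p) ^ 4 < 1 / real p"
    using power_strict_decreasing[of 1 4 "1 / real p"] ip by simp
  then have abs_r: "padic_abs p (of_nat r) \<ge> 1 / real p"
    using padic_abs_dominant[of "of_int A" "of_nat r"] Ar absA by simp
  then have r0: "(of_nat r :: rat) \<noteq> 0"
    using ip by (metis padic_abs_0 not_le)
  define e where "e = of_int A / (of_nat r :: rat)"
  have "e - 1 = of_int (A - int r) / of_nat r"
    using r0 by (simp add: e_def diff_divide_distrib)
  then have "padic_abs p (e - 1) = padic_abs p (of_int (A - int r)) / padic_abs p (of_nat r)"
    by (simp add: padic_abs_divide)
  also have "\<dots> \<le> (1 / real p) ^ 4 / (1 / real p)"
    using Ar abs_r ip by (intro frac_le) auto
  also have "\<dots> = (1 / real p) ^ 3"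
    using p_gt_1 by (simp add: power_numeral_reduce field_simps)
  finally have "padic_abs p (e - 1) \<le> (1 / real p) ^ 3" .
  moreover have "q = of_nat r * (c * c) * e"
    using qA r0 by (simp add: e_def)
  ultimately show thesis
    using that r_le by blast
qed

text \<open>Newton iteration: the error of \<open>w + (t - w\<^sup>2) / (2 * w)\<close> is the square of the correction.\<close>

lemma rat_approx_sqrt:
  assumes t: "padic_abs p (t - 1) \<le> (1 / real p) ^ 3"
  shows "\<exists>w. padic_abs p (w * w - t) \<le> (1 / real p) ^ (3 + k) \<and> padic_abs p (w - 1) \<le> (1 / real p) ^ 2"
proof (induction k)
  case 0
  show ?case
    using t p_gt_1 by (intro exI[of _ 1]) (simp add: padic_abs_minus_commute[of 1])
next
  case (Suc k)
  define i where "i = 1 / real p"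
  have i: "0 < i" "i < 1" "1 / i = real p"
    using p_gt_1 by (simp_all add: i_def)
  obtain w where w: "padic_abs p (w * w - t) \<le> i ^ (3 + k)" "padic_abs p (w - 1) \<le> i ^ 2"
    using Suc by (auto simp: i_def)
  have "i ^ 2 < 1"
    using i by (simp add: power_less_one_iff)
  then have absw: "padic_abs p w \<ge> 1"
    using padic_abs_dominant[of 1 w] w(2) by (simp add: padic_abs_minus_commute[of 1])
  have abs2: "padic_abs p 2 \<ge> i"
    using padic_abs_2 by (simp add: i_def)
  have w0: "w \<noteq> 0"
    using absw by auto
  define d where "d = (t - w * w) / (2 * w)"
  \<comment> \<open>Dividing by \<open>2 * w\<close> costs at most one factor \<open>p\<close>, so
    the correction is bounded by \<open>i ^ (2 + k)\<close>.\<close>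
  have "padic_abs p d = padic_abs p (w * w - t) / (padic_abs p 2 * padic_abs p w)"
    by (simp add: d_def padic_abs_divide padic_abs_mult padic_abs_minus_commute)
  also have "\<dots> \<le> i ^ (3 + k) / (i * 1)"
    using w(1) absw abs2 i by (intro frac_le mult_mono) auto
  also have "\<dots> = i ^ (2 + k)"
    using i by (simp add: numeral_3_eq_3)
  finally have d: "padic_abs p d \<le> i ^ (2 + k)" .
  have "(w + d) * (w + d) - t = d * d"
    using w0 by (simp add: d_def field_simps)
  then have "padic_abs p ((w + d) * (w + d) - t) = padic_abs p d * padic_abs p d"
    by (simp add: padic_abs_mult)
  also have "\<dots> \<le> i ^ (2 + k) * i ^ (2 + k)"
    using d i by (intro mult_mono) auto
  also have "\<dots> = i ^ (2 + k + (2 + k))"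
    by (simp add: power_add)
  \<comment> \<open>The squared correction has exponent 4 + 2k, at least the required 4 + k; this is
    what the initial accuracy 3 provides.\<close>
  also have "\<dots> \<le> i ^ (3 + Suc k)"
    using i by (intro power_decreasing) auto
  finally have "padic_abs p ((w + d) * (w + d) - t) \<le> i ^ (3 + Suc k)" .
  moreover have "padic_abs p (w + d - 1) \<le> i ^ 2"
  proof -
    have "i ^ (2 + k) \<le> i ^ 2"
      using i by (intro power_decreasing) auto
    then show ?thesis
      using padic_abs_add_le[of "w - 1" "i ^ 2" d] w(2) d by (simp add: algebra_simps)
  qed
  ultimately show ?case
    unfolding i_def by blast
qed

section \<open>Cauchy and null sequences of rationals\<close>

definition Cauchy_seq :: "(nat \<Rightarrow> rat) \<Rightarrow> bool" where
  "Cauchy_seq s \<longleftrightarrow> (\<forall>\<epsilon>>0. \<exists>N. \<forall>m\<ge>N. \<forall>n\<ge>N. padic_abs p (s m - s n) < \<epsilon>)"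

definition null_seq :: "(nat \<Rightarrow> rat) \<Rightarrow> bool" where
  "null_seq s \<longleftrightarrow> (\<forall>\<epsilon>>0. \<exists>N. \<forall>n\<ge>N. padic_abs p (s n) < \<epsilon>)"

lemma Cauchy_seq_bounded:
  assumes "Cauchy_seq s"
  obtains B N where "B > 0" "\<And>n. n \<ge> N \<Longrightarrow> padic_abs p (s n) \<le> B"
proof -
  obtain N where N: "\<forall>m\<ge>N. \<forall>n\<ge>N. padic_abs p (s m - s n) < 1"
    using assms zero_less_one unfolding Cauchy_seq_def by blast
  have "padic_abs p (s n) \<le> max 1 (padic_abs p (s N))" if "n \<ge> N" for n
  proof -
    have "padic_abs p (s n - s N) < 1"
      using N that by blast
    then have "padic_abs p (s n - s N) \<le> max 1 (padic_abs p (s N))"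
      by simp
    then have "padic_abs p (s n - s N + s N) \<le> max 1 (padic_abs p (s N))"
      by (rule padic_abs_add_le) simp
    then show ?thesis by simp
  qed
  then show thesis
    using that[of "max 1 (padic_abs p (s N))" N] by simp
qed

lemma Cauchy_seq_const: "Cauchy_seq (\<lambda>_. c)"
  by (simp add: Cauchy_seq_def)

lemma Cauchy_seq_add:
  assumes "Cauchy_seq s" "Cauchy_seq t"
  shows "Cauchy_seq (\<lambda>n. s n + t n)"
  unfolding Cauchy_seq_def
proof (intro allI impI)
  fix \<epsilon> :: real assume "\<epsilon> > 0"
  then obtain N M where NM: "\<forall>m\<ge>N. \<forall>n\<ge>N. padic_abs p (s m - s n) < \<epsilon>"
    "\<forall>m\<ge>M. \<forall>n\<ge>M. padic_abs p (t m - t n) < \<epsilon>"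
    using assms unfolding Cauchy_seq_def by blast
  have "padic_abs p (s m + t m - (s n + t n)) < \<epsilon>" if "m \<ge> max N M" "n \<ge> max N M" for m n
    using padic_abs_add_less[of "s m - s n" \<epsilon> "t m - t n"] NM that by (simp add: algebra_simps)
  then show "\<exists>N. \<forall>m\<ge>N. \<forall>n\<ge>N. padic_abs p (s m + t m - (s n + t n)) < \<epsilon>"
    by blast
qed

lemma Cauchy_seq_minus: "Cauchy_seq s \<Longrightarrow> Cauchy_seq (\<lambda>n. - s n)"
  by (simp add: Cauchy_seq_def padic_abs_minus_commute)

lemma null_seq_add:
  assumes "null_seq s" "null_seq t"
  shows "null_seq (\<lambda>n. s n + t n)"
  unfolding null_seq_def
proof (intro allI impI)
  fix \<epsilon> :: real assume "\<epsilon> > 0"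
  then obtain N M where NM: "\<forall>n\<ge>N. padic_abs p (s n) < \<epsilon>" "\<forall>n\<ge>M. padic_abs p (t n) < \<epsilon>"
    using assms unfolding null_seq_def by blast
  then have "padic_abs p (s n + t n) < \<epsilon>" if "n \<ge> max N M" for n
    using that by (intro padic_abs_add_less) auto
  then show "\<exists>N. \<forall>n\<ge>N. padic_abs p (s n + t n) < \<epsilon>"
    by blast
qed

lemma null_seq_mult:
  assumes "Cauchy_seq s" "null_seq t"
  shows "null_seq (\<lambda>n. s n * t n)"
  unfolding null_seq_def
proof (intro allI impI)
  fix \<epsilon> :: real assume \<epsilon>: "\<epsilon> > 0"
  obtain B N where B: "B > 0" "\<And>n. n \<ge> N \<Longrightarrow> padic_abs p (s n) \<le> B"
    using Cauchy_seq_bounded[OF assms(1)] by metis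
  have "\<epsilon> / B > 0"
    using \<epsilon> B(1) by simp
  then obtain M where M: "\<forall>n\<ge>M. padic_abs p (t n) < \<epsilon> / B"
    using assms(2) unfolding null_seq_def by blast
  have "padic_abs p (s n * t n) < \<epsilon>" if "n \<ge> max N M" for n
  proof -
    have "padic_abs p (s n * t n) \<le> B * padic_abs p (t n)"
      unfolding padic_abs_mult using B(2) that by (intro mult_right_mono) auto
    also have "\<dots> < \<epsilon>"
      using M that B(1) by (simp add: field_simps)
    finally show ?thesis .
  qed
  then show "\<exists>N. \<forall>n\<ge>N. padic_abs p (s n * t n) < \<epsilon>"
    by blast
qed

lemma null_seq_Cauchy:
  assumes "null_seq s"
  shows "Cauchy_seq s"
  unfolding Cauchy_seq_def
proof (intro allI impI)
  fix \<epsilon> :: real assume "\<epsilon> > 0"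
  then obtain N where "\<forall>n\<ge>N. padic_abs p (s n) < \<epsilon>"
    using assms unfolding null_seq_def by blast
  then have "\<forall>m\<ge>N. \<forall>n\<ge>N. padic_abs p (s m - s n) < \<epsilon>"
    using padic_abs_diff_less by blast
  then show "\<exists>N. \<forall>m\<ge>N. \<forall>n\<ge>N. padic_abs p (s m - s n) < \<epsilon>"
    by blast
qed

lemma Cauchy_seq_mult:
  assumes "Cauchy_seq s" "Cauchy_seq t"
  shows "Cauchy_seq (\<lambda>n. s n * t n)"
  unfolding Cauchy_seq_def
proof (intro allI impI)
  fix \<epsilon> :: real assume \<epsilon>: "\<epsilon> > 0"
  obtain B N where B: "B > 0" "\<And>n. n \<ge> N \<Longrightarrow> padic_abs p (s n) \<le> B"
    using Cauchy_seq_bounded[OF assms(1)] by metis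
  obtain C M where C: "C > 0" "\<And>n. n \<ge> M \<Longrightarrow> padic_abs p (t n) \<le> C"
    using Cauchy_seq_bounded[OF assms(2)] by metis
  have "\<epsilon> / B > 0" "\<epsilon> / C > 0"
    using \<epsilon> B(1) C(1) by simp_all
  then obtain N' M' where N': "\<forall>m\<ge>N'. \<forall>n\<ge>N'. padic_abs p (t m - t n) < \<epsilon> / B"
    and M': "\<forall>m\<ge>M'. \<forall>n\<ge>M'. padic_abs p (s m - s n) < \<epsilon> / C"
    using assms unfolding Cauchy_seq_def by meson
  have "padic_abs p (s m * t m - s n * t n) < \<epsilon>"
    if mn: "m \<ge> N + M + N' + M'" "n \<ge> N + M + N' + M'" for m n
  proof -
    have "padic_abs p (s m * (t m - t n)) \<le> B * padic_abs p (t m - t n)"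
      unfolding padic_abs_mult using B(2) mn by (intro mult_right_mono) auto
    also have "\<dots> < \<epsilon>"
      using N' mn B(1) by (simp add: field_simps)
    finally have 1: "padic_abs p (s m * (t m - t n)) < \<epsilon>" .
    have "padic_abs p ((s m - s n) * t n) \<le> padic_abs p (s m - s n) * C"
      unfolding padic_abs_mult using C(2) mn by (intro mult_left_mono) auto
    also have "\<dots> < \<epsilon>"
      using M' mn C(1) by (simp add: field_simps)
    finally have 2: "padic_abs p ((s m - s n) * t n) < \<epsilon>" .
    have "s m * t m - s n * t n = s m * (t m - t n) + (s m - s n) * t n"
      by (simp add: algebra_simps)
    then show ?thesis
      using padic_abs_add_less[OF 1 2] by simp
  qed
  then show "\<exists>N. \<forall>m\<ge>N. \<forall>n\<ge>N. padic_abs p (s m * t m - s n * t n) < \<epsilon>"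
    by blast
qed

text \<open>From some index on, the terms of a non-null sequence are relatively close to one fixed
  term \<open>q\<close>, so the square class of \<open>q\<close> serves them all. After dividing by
  it, the terms are near one, and increasingly accurate approximate square roots form a Cauchy
  sequence.\<close>

lemma Cauchy_square_class:
  assumes s: "Cauchy_seq s"
  obtains r w where "r \<le> p ^ 4" "Cauchy_seq w" "null_seq (\<lambda>n. s n - of_nat r * (w n * w n))"
proof (cases "null_seq s")
  case True
  \<comment> \<open>Null sequences represent zero and take the multiplier 0.\<close>
  then show thesis
    using that[of 0 "\<lambda>_. 0"] Cauchy_seq_const by simp
next
  case False
  define i where "i = 1 / real p"
  have i: "0 < i" "i < 1"
    using p_gt_1 by (simp_all add: i_def)
  obtain \<epsilon> where \<epsilon>: "\<epsilon> > 0" "\<forall>N. \<exists>n\<ge>N. padic_abs p (s n) \<ge> \<epsilon>"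
    using False by (auto simp: null_seq_def not_less)
  have "\<epsilon> * i ^ 3 > 0"
    using \<epsilon>(1) i by simp
  then obtain N where N: "\<forall>m\<ge>N. \<forall>n\<ge>N. padic_abs p (s m - s n) < \<epsilon> * i ^ 3"
    using s unfolding Cauchy_seq_def by blast
  obtain n0 where n0: "n0 \<ge> N" "padic_abs p (s n0) \<ge> \<epsilon>"
    using \<epsilon>(2) by blast
  define q where "q = s n0"
  have q0: "q \<noteq> 0"
    using n0(2) \<epsilon>(1) by (auto simp: q_def)
  obtain r c e where rce: "r \<le> p ^ 4" "q = of_nat r * (c * c) * e" "padic_abs p (e - 1) \<le> i ^ 3"
    using rat_square_class[OF q0] unfolding i_def by metis
  have e0: "e \<noteq> 0"
    using q0 rce(2) by auto
  have "i ^ 3 < 1"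
    using i by (simp add: power_less_one_iff)
  have "padic_abs p (e - 1 + 1) \<le> 1"
    using rce(3) \<open>i ^ 3 < 1\<close> by (intro padic_abs_add_le) auto
  then have abs_e: "padic_abs p e \<le> 1"
    by simp
  \<comment> \<open>The terms divided by \<open>of_nat r * (c * c)\<close>. Below \<open>N\<close>
    the value is \<open>e\<close>, so that the bound \<open>t1\<close> holds at every index.\<close>
  define t where "t n = e * (if n \<ge> N then s n / q else 1)" for n
  have st: "s n = of_nat r * (c * c) * t n" if "n \<ge> N" for n
    using that rce(2) q0 by (simp add: t_def)
  have t1: "padic_abs p (t n - 1) \<le> i ^ 3" for n
  proof (cases "n \<ge> N")
    case True
    have "padic_abs p (s n / q - 1) = padic_abs p (s n - q) / padic_abs p q"
      using q0 by (simp add: padic_abs_divide[symmetric] diff_divide_distrib)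
    also have "\<dots> \<le> (\<epsilon> * i ^ 3) / \<epsilon>"
      using N True n0 \<epsilon>(1) i by (intro frac_le) (auto simp: q_def less_imp_le)
    also have "\<dots> = i ^ 3"
      using \<epsilon>(1) by simp
    finally have "padic_abs p e * padic_abs p (s n / q - 1) \<le> 1 * i ^ 3"
      using abs_e by (intro mult_mono) auto
    then have "padic_abs p (e * (s n / q - 1)) \<le> i ^ 3"
      by (simp add: padic_abs_mult)
    then have "padic_abs p (e * (s n / q - 1) + (e - 1)) \<le> i ^ 3"
      using rce(3) by (rule padic_abs_add_le)
    moreover have "t n - 1 = e * (s n / q - 1) + (e - 1)"
      using True by (simp add: t_def algebra_simps)
    ultimately show ?thesis by metis
  qed (use rce(3) in \<open>simp add: t_def\<close>)
  have t_Cauchy: "Cauchy_seq t"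
  proof -
    have *: "Cauchy_seq (\<lambda>n. (e / q) * s n)"
      by (rule Cauchy_seq_mult[OF Cauchy_seq_const s])
    show ?thesis
      unfolding Cauchy_seq_def
    proof (intro allI impI)
      fix \<delta> :: real assume "\<delta> > 0"
      then obtain M where M: "\<forall>m\<ge>M. \<forall>n\<ge>M. padic_abs p ((e / q) * s m - (e / q) * s n) < \<delta>"
        using * unfolding Cauchy_seq_def by blast
      have "padic_abs p (t m - t n) < \<delta>" if "m \<ge> max N M" "n \<ge> max N M" for m n
        using M that by (simp add: t_def)
      then show "\<exists>M. \<forall>m\<ge>M. \<forall>n\<ge>M. padic_abs p (t m - t n) < \<delta>"
        by blast
    qed
  qed
  have "\<exists>w. padic_abs p (w * w - t n) \<le> i ^ (3 + n) \<and> padic_abs p (w - 1) \<le> i ^ 2" for n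
    using rat_approx_sqrt[of "t n" n] t1[of n] unfolding i_def by blast
  then obtain w where w: "\<And>n. padic_abs p (w n * w n - t n) \<le> i ^ (3 + n)"
    "\<And>n. padic_abs p (w n - 1) \<le> i ^ 2"
    by metis
  have small: "\<exists>M. \<forall>n\<ge>M. i ^ (3 + n) < \<delta>" if \<delta>: "\<delta> > 0" for \<delta> :: real
  proof -
    obtain M where M: "i ^ M < \<delta>"
      using real_arch_pow_inv[OF \<delta> i(2)] by blast
    have "i ^ (3 + n) < \<delta>" if "n \<ge> M" for n
    proof -
      have "i ^ (3 + n) \<le> i ^ M"
        using i that by (intro power_decreasing) auto
      then show ?thesis
        using M by simp
    qed
    then show ?thesis by blast
  qed
  have null_w: "null_seq (\<lambda>n. w n * w n - t n)"
    unfolding null_seq_def using small w(1) by (meson le_less_trans)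
  \<comment> \<open>All roots are near one, so sums of two of them are near 2 and stay away from
    zero. This prevents switching between the two signs of the root, and \<open>w m - w n\<close> is
    controlled by the difference of squares.\<close>
  have sum_w: "padic_abs p (w m + w n) \<ge> i" for m n
  proof -
    have "padic_abs p ((w m - 1) + (w n - 1)) \<le> i ^ 2"
      using w(2) by (intro padic_abs_add_le)
    then have "padic_abs p (2 - (w m + w n)) \<le> i ^ 2"
      using padic_abs_minus_commute[of 2 "w m + w n"] by (simp add: algebra_simps)
    also have "i ^ 2 < i"
      using i by (simp add: power2_eq_square)
    also have "i \<le> padic_abs p 2"
      using padic_abs_2 by (simp add: i_def)
    finally show ?thesis
      using padic_abs_dominant[of 2 "w m + w n"] padic_abs_2 by (simp add: i_def)
  qed
  have w_Cauchy: "Cauchy_seq w"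
    unfolding Cauchy_seq_def
  proof (intro allI impI)
    fix \<delta> :: real assume "\<delta> > 0"
    then have "\<delta> * i > 0"
      using i by simp
    moreover have "Cauchy_seq (\<lambda>n. w n * w n)"
      using Cauchy_seq_add[OF null_seq_Cauchy[OF null_w] t_Cauchy] by simp
    ultimately obtain M where M: "\<forall>m\<ge>M. \<forall>n\<ge>M. padic_abs p (w m * w m - w n * w n) < \<delta> * i"
      unfolding Cauchy_seq_def by blast
    have "padic_abs p (w m - w n) < \<delta>" if "m \<ge> M" "n \<ge> M" for m n
    proof -
      have "padic_abs p (w m - w n) * i \<le> padic_abs p (w m - w n) * padic_abs p (w m + w n)"
        using sum_w by (intro mult_left_mono) auto
      also have "\<dots> = padic_abs p (w m * w m - w n * w n)"
        by (simp add: padic_abs_mult[symmetric] algebra_simps)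
      also have "\<dots> < \<delta> * i"
        using M that by blast
      finally show ?thesis
        using i(1) by simp
    qed
    then show "\<exists>M. \<forall>m\<ge>M. \<forall>n\<ge>M. padic_abs p (w m - w n) < \<delta>"
      by blast
  qed
  show thesis
  proof (rule that[OF rce(1)])
    show "Cauchy_seq (\<lambda>n. c * w n)"
      by (rule Cauchy_seq_mult[OF Cauchy_seq_const w_Cauchy])
    have *: "null_seq (\<lambda>n. - (of_nat r * (c * c)) * (w n * w n - t n))"
      by (rule null_seq_mult[OF Cauchy_seq_const null_w])
    show "null_seq (\<lambda>n. s n - of_nat r * (c * w n * (c * w n)))"
      unfolding null_seq_def
    proof (intro allI impI)
      fix \<delta> :: real assume "\<delta> > 0"
      then obtain M where M: "\<forall>n\<ge>M. padic_abs p (- (of_nat r * (c * c)) * (w n * w n - t n)) < \<delta>"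
        using * unfolding null_seq_def by blast
      have "padic_abs p (s n - of_nat r * (c * w n * (c * w n))) < \<delta>" if "n \<ge> max N M" for n
      proof -
        have "s n - of_nat r * (c * w n * (c * w n)) = - (of_nat r * (c * c)) * (w n * w n - t n)"
          using st[of n] that by (simp add: algebra_simps)
        then show ?thesis
          using M that by simp
      qed
      then show "\<exists>M. \<forall>n\<ge>M. padic_abs p (s n - of_nat r * (c * w n * (c * w n))) < \<delta>"
        by blast
    qed
  qed
qed

section \<open>The p-adic field as a quotient of the ring of Cauchy sequences\<close>

lemma padic_Cauchy_ring_simps [simp]:
  "carrier (padic_Cauchy_ring p) = {s. Cauchy_seq s}"
  "s \<otimes>\<^bsub>padic_Cauchy_ring p\<^esub> t = (\<lambda>n. s n * t n)"
  "s \<oplus>\<^bsub>padic_Cauchy_ring p\<^esub> t = (\<lambda>n. s n + t n)"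
  "\<one>\<^bsub>padic_Cauchy_ring p\<^esub> = (\<lambda>_. 1)"
  "\<zero>\<^bsub>padic_Cauchy_ring p\<^esub> = (\<lambda>_. 0)"
  by (auto simp: padic_Cauchy_ring_def Cauchy_seq_def)

lemma padic_Cauchy_cring: "cring (padic_Cauchy_ring p)"
proof (rule cringI)
  show "abelian_group (padic_Cauchy_ring p)"
  proof (rule abelian_groupI)
    fix s assume "s \<in> carrier (padic_Cauchy_ring p)"
    then show "\<exists>t\<in>carrier (padic_Cauchy_ring p). t \<oplus>\<^bsub>padic_Cauchy_ring p\<^esub> s = \<zero>\<^bsub>padic_Cauchy_ring p\<^esub>"
      by (intro bexI[of _ "\<lambda>n. - s n"]) (simp_all add: Cauchy_seq_minus)
  qed (simp_all add: Cauchy_seq_add Cauchy_seq_const ac_simps)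
  show "comm_monoid (padic_Cauchy_ring p)"
    by (rule comm_monoidI) (simp_all add: Cauchy_seq_mult Cauchy_seq_const ac_simps)
qed (simp add: algebra_simps)

lemma padic_Cauchy_minus:
  assumes "Cauchy_seq s"
  shows "\<ominus>\<^bsub>padic_Cauchy_ring p\<^esub> s = (\<lambda>n. - s n)"
proof -
  interpret cring "padic_Cauchy_ring p"
    by (rule padic_Cauchy_cring)
  show ?thesis
    using assms by (intro minus_equality) (simp_all add: Cauchy_seq_minus)
qed

lemma padic_null_ideal_iff: "s \<in> padic_null_ideal p \<longleftrightarrow> null_seq s"
  by (simp add: padic_null_ideal_def null_seq_def lim_sequentially dist_real_def)

lemma ideal_padic_null: "ideal (padic_null_ideal p) (padic_Cauchy_ring p)"
proof -
  interpret cring "padic_Cauchy_ring p"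
    by (rule padic_Cauchy_cring)
  show ?thesis
  proof (rule idealI)
    show "ring (padic_Cauchy_ring p)"
      by (rule ring_axioms)
    show "subgroup (padic_null_ideal p) (add_monoid (padic_Cauchy_ring p))"
    proof (rule add.subgroupI)
      show "padic_null_ideal p \<subseteq> carrier (padic_Cauchy_ring p)"
        using null_seq_Cauchy by (auto simp: padic_null_ideal_iff)
      have "(\<lambda>_. 0) \<in> padic_null_ideal p"
        by (simp add: padic_null_ideal_iff null_seq_def)
      then show "padic_null_ideal p \<noteq> {}"
        by blast
      show "\<ominus>\<^bsub>padic_Cauchy_ring p\<^esub> s \<in> padic_null_ideal p" if "s \<in> padic_null_ideal p" for s
        using that null_seq_Cauchy by (simp add: padic_null_ideal_iff padic_Cauchy_minus null_seq_def)
      show "s \<oplus>\<^bsub>padic_Cauchy_ring p\<^esub> t \<in> padic_null_ideal p"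
        if "s \<in> padic_null_ideal p" "t \<in> padic_null_ideal p" for s t
        using that by (simp add: padic_null_ideal_iff null_seq_add)
    qed
    fix s t assume *: "s \<in> padic_null_ideal p" "t \<in> carrier (padic_Cauchy_ring p)"
    then have "null_seq (\<lambda>n. t n * s n)"
      by (intro null_seq_mult) (auto simp: padic_null_ideal_iff)
    then show "t \<otimes>\<^bsub>padic_Cauchy_ring p\<^esub> s \<in> padic_null_ideal p"
      "s \<otimes>\<^bsub>padic_Cauchy_ring p\<^esub> t \<in> padic_null_ideal p"
      by (simp_all add: padic_null_ideal_iff mult.commute)
  qed
qed

lemma padic_class_eq_iff:
  assumes "Cauchy_seq s" "Cauchy_seq t"
  shows "padic_null_ideal p +>\<^bsub>padic_Cauchy_ring p\<^esub> s = padic_null_ideal p +>\<^bsub>padic_Cauchy_ring p\<^esub> t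
    \<longleftrightarrow> null_seq (\<lambda>n. s n - t n)"
proof -
  interpret cring "padic_Cauchy_ring p"
    by (rule padic_Cauchy_cring)
  show ?thesis
    using quotient_eq_iff_same_a_r_cos[OF ideal_padic_null, of s t] assms
    by (simp add: a_minus_def padic_Cauchy_minus padic_null_ideal_iff)
qed

lemma padic_field_square_class:
  assumes "x \<in> carrier (padic_field p)"
  shows "\<exists>r\<le>p ^ 4. \<exists>y\<in>carrier (padic_field p).
    x = ring_numeral (padic_field p) r \<otimes>\<^bsub>padic_field p\<^esub> (y \<otimes>\<^bsub>padic_field p\<^esub> y)"
proof -
  interpret ideal "padic_null_ideal p" "padic_Cauchy_ring p"
    by (rule ideal_padic_null)
  let ?h = "\<lambda>s. padic_null_ideal p +>\<^bsub>padic_Cauchy_ring p\<^esub> s"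
  interpret h: ring_hom_ring "padic_Cauchy_ring p" "padic_field p" ?h
    unfolding padic_field_def by (rule rcos_ring_hom_ring)
  have num: "ring_numeral (padic_field p) r = ?h (\<lambda>_. of_nat r)" for r
  proof (induction r)
    case 0
    then show ?case
      using h.hom_zero by simp
  next
    case (Suc r)
    then show ?case
      using h.hom_add[of "\<lambda>_. of_nat r" "\<lambda>_. 1"] h.hom_one by (simp add: Cauchy_seq_const add.commute)
  qed
  obtain s where s: "Cauchy_seq s" "x = ?h s"
    using assms by (auto simp: padic_field_def FactRing_def A_RCOSETS_def RCOSETS_def a_r_coset_def)
  obtain r w where r: "r \<le> p ^ 4" and w: "Cauchy_seq w" "null_seq (\<lambda>n. s n - of_nat r * (w n * w n))"
    using Cauchy_square_class[OF s(1)] by metis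
  have c: "Cauchy_seq (\<lambda>n. w n * w n)" "Cauchy_seq (\<lambda>_. of_nat r)"
    using w(1) by (simp_all add: Cauchy_seq_mult Cauchy_seq_const)
  have "x = ?h (\<lambda>n. of_nat r * (w n * w n))"
    unfolding s(2) using w(2) by (simp add: padic_class_eq_iff s(1) Cauchy_seq_mult c)
  also have "\<dots> = ring_numeral (padic_field p) r \<otimes>\<^bsub>padic_field p\<^esub> ?h (\<lambda>n. w n * w n)"
    using h.hom_mult[of "\<lambda>_. of_nat r" "\<lambda>n. w n * w n"] c by (simp add: num)
  also have "?h (\<lambda>n. w n * w n) = ?h w \<otimes>\<^bsub>padic_field p\<^esub> ?h w"
    using h.hom_mult[of w w] w(1) by simp
  finally show ?thesis
    using r w(1) h.hom_closed[of w] by (intro exI[of _ r] conjI bexI[of _ "?h w"]) simp_all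
qed

lemma padic_field_two: "\<one>\<^bsub>padic_field p\<^esub> \<oplus>\<^bsub>padic_field p\<^esub> \<one>\<^bsub>padic_field p\<^esub> \<noteq> \<zero>\<^bsub>padic_field p\<^esub>"
proof
  interpret ideal "padic_null_ideal p" "padic_Cauchy_ring p"
    by (rule ideal_padic_null)
  let ?h = "\<lambda>s. padic_null_ideal p +>\<^bsub>padic_Cauchy_ring p\<^esub> s"
  interpret h: ring_hom_ring "padic_Cauchy_ring p" "padic_field p" ?h
    unfolding padic_field_def by (rule rcos_ring_hom_ring)
  assume "\<one>\<^bsub>padic_field p\<^esub> \<oplus>\<^bsub>padic_field p\<^esub> \<one>\<^bsub>padic_field p\<^esub> = \<zero>\<^bsub>padic_field p\<^esub>"
  then have "?h (\<lambda>_. 2) = ?h (\<lambda>_. 0)"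
    using h.hom_add[of "\<lambda>_. 1" "\<lambda>_. 1"] h.hom_one h.hom_zero by (simp add: Cauchy_seq_const)
  then have "null_seq (\<lambda>_. 2)"
    by (simp add: padic_class_eq_iff Cauchy_seq_const)
  then show False
    using padic_abs_pos[of 2] by (auto simp: null_seq_def)
qed

end


section \<open>First-order sentences on square classes\<close>

primrec numeral_tm :: "nat \<Rightarrow> ring_sym tm" where
  "numeral_tm 0 = Fn RZero []"
| "numeral_tm (Suc n) = Fn RAdd [numeral_tm n, Fn ROne []]"

definition square_multiple_fm :: "nat \<Rightarrow> ring_sym fm" where
  "square_multiple_fm r = Ex 1 (Eq (Var 0) (Fn RMult [numeral_tm r, Fn RMult [Var 1, Var 1]]))"

text \<open>The syntax has neither disjunction nor universal quantifier, so "some multiplier up to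
  \<open>n\<close> works" is expressed through its negation, with \<open>Var 0\<close> as the
  element tested.\<close>

primrec no_square_multiple_fm :: "nat \<Rightarrow> ring_sym fm" where
  "no_square_multiple_fm 0 = Neg (square_multiple_fm 0)"
| "no_square_multiple_fm (Suc n) = Conj (Neg (square_multiple_fm (Suc n))) (no_square_multiple_fm n)"

definition square_classes_fm :: "nat \<Rightarrow> ring_sym fm" where
  "square_classes_fm N = Neg (Ex 0 (no_square_multiple_fm N))"

definition two_nonzero_fm :: "ring_sym fm" where
  "two_nonzero_fm = Neg (Eq (Fn RAdd [Fn ROne [], Fn ROne []]) (Fn RZero []))"

lemma wf_numeral_tm: "wf_tm (numeral_tm n)" "fv_tm (numeral_tm n) = {}"
  by (induction n) auto

lemma square_classes_sentence:
  "wf_fm (square_classes_fm N)" "fv_fm (square_classes_fm N) = {}"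
proof -
  have "wf_fm (no_square_multiple_fm N)" "fv_fm (no_square_multiple_fm N) \<subseteq> {0}"
    by (induction N) (auto simp: square_multiple_fm_def wf_numeral_tm)
  then show "wf_fm (square_classes_fm N)" "fv_fm (square_classes_fm N) = {}"
    by (auto simp: square_classes_fm_def)
qed

lemma eval_numeral_tm: "eval_tm (ring_structure R) e (numeral_tm n) = ring_numeral R n"
  by (induction n) (simp_all add: ring_structure_def)

lemma sat_square_classes:
  "sat (ring_structure R) e (square_classes_fm N) \<longleftrightarrow>
   (\<forall>a\<in>carrier R. \<exists>r\<le>N. \<exists>b\<in>carrier R. a = ring_numeral R r \<otimes>\<^bsub>R\<^esub> (b \<otimes>\<^bsub>R\<^esub> b))"
proof -
  have "sat (ring_structure R) e (square_multiple_fm r) \<longleftrightarrow>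
      (\<exists>b\<in>carrier R. e 0 = ring_numeral R r \<otimes>\<^bsub>R\<^esub> (b \<otimes>\<^bsub>R\<^esub> b))" for e r
    by (simp add: square_multiple_fm_def eval_numeral_tm) (simp add: ring_structure_def)
  then have "sat (ring_structure R) e (no_square_multiple_fm N) \<longleftrightarrow>
      (\<forall>r\<le>N. \<not> (\<exists>b\<in>carrier R. e 0 = ring_numeral R r \<otimes>\<^bsub>R\<^esub> (b \<otimes>\<^bsub>R\<^esub> b)))" for e
    by (induction N) (auto simp: le_Suc_eq)
  then show ?thesis
    by (simp add: square_classes_fm_def) (simp add: ring_structure_def)
qed

text \<open>Nonemptiness guarantees that an assignment into the universe exists; otherwise
  \<open>models\<close> would hold vacuously.\<close>

lemma models_iff_sat:
  assumes "univ M \<noteq> {}" "\<And>e e'. sat M e \<phi> = sat M e' \<phi>"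
  shows "models M \<phi> \<longleftrightarrow> sat M e \<phi>"
proof -
  obtain a where "a \<in> univ M"
    using assms(1) by blast
  then have "range (\<lambda>_::nat. a) \<subseteq> univ M"
    by auto
  then show ?thesis
    unfolding models_def using assms(2) by blast
qed

lemma (in ring) models_square_classes:
  "models (ring_structure R) (square_classes_fm N) \<longleftrightarrow>
   (\<forall>a\<in>carrier R. \<exists>r\<le>N. \<exists>b\<in>carrier R. a = ring_numeral R r \<otimes> (b \<otimes> b))"
proof -
  have "univ (ring_structure R) \<noteq> {}"
    using zero_closed by (auto simp: ring_structure_def)
  then show ?thesis
    by (subst models_iff_sat) (simp_all add: sat_square_classes)
qed

lemma (in ring) models_two_nonzero:
  "models (ring_structure R) two_nonzero_fm \<longleftrightarrow> \<one> \<oplus> \<one> \<noteq> \<zero>"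
proof -
  have "univ (ring_structure R) \<noteq> {}"
    using zero_closed by (auto simp: ring_structure_def)
  then show ?thesis
    by (subst models_iff_sat) (simp_all add: two_nonzero_fm_def ring_structure_def)
qed

section \<open>Exclusion of p-adically closed fields\<close>

context heisenberg_bi
begin

text \<open>The finite list of square classes and the inequality 1 + 1 \<noteq> 0 are first-order,
  so both transfer from the p-adic numbers. The multipliers are sums of ones, which every
  endomorphism fixes.\<close>

lemma not_p_adically_closed:
  assumes p: "Factorial_Ring.prime p"
  shows "\<not> p_adically_closed_field p R"
proof
  assume "p_adically_closed_field p R"
  then have equiv: "elementarily_equivalent (ring_structure R) (ring_structure (padic_field p))"
    by (simp add: p_adically_closed_field_def)
  interpret Q: ring "padic_field p"
    unfolding padic_field_def by (rule ideal.quotient_is_ring[OF ideal_padic_null[OF p]])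
  have "models (ring_structure (padic_field p)) (square_classes_fm (p ^ 4))"
    unfolding Q.models_square_classes using padic_field_square_class[OF p] by blast
  then have "models (ring_structure R) (square_classes_fm (p ^ 4))"
    using equiv square_classes_sentence by (auto simp: elementarily_equivalent_def)
  then have sq: "\<exists>r. \<exists>b\<in>carrier R. a = ring_numeral R r \<otimes> (b \<otimes> b)" if "a \<in> carrier R" for a
    using that unfolding models_square_classes by blast
  have "models (ring_structure (padic_field p)) two_nonzero_fm"
    unfolding Q.models_two_nonzero by (rule padic_field_two[OF p])
  then have "models (ring_structure R) two_nonzero_fm"
    using equiv by (auto simp: elementarily_equivalent_def two_nonzero_fm_def)
  then have two: "\<one> \<oplus> \<one> \<noteq> \<zero>"
    by (simp add: models_two_nonzero)
  have num_closed: "ring_numeral R n \<in> carrier R" for n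
    by (induction n) simp_all
  have num_fixed: "\<phi> (ring_numeral R n) = ring_numeral R n" if "\<phi> \<in> ring_hom R R" for \<phi> n
  proof -
    interpret \<phi>: ring_hom_ring R R \<phi>
      using that ring_axioms by (simp add: ring_hom_ring_def ring_hom_ring_axioms_def)
    show ?thesis
      by (induction n) (simp_all add: num_closed)
  qed
  obtain \<phi> x where "\<phi> \<in> ring_hom R R" "x \<in> carrier R" "\<phi> (\<phi> x) \<noteq> x"
    "\<And>y. y \<in> carrier R \<Longrightarrow> \<phi> (\<phi> (\<phi> (\<phi> y))) = y"
    using endo_of_order_4[OF two] by metis
  moreover have "\<exists>r\<in>carrier R. \<exists>b\<in>carrier R.
      (\<forall>\<phi>\<in>ring_hom R R. \<phi> r = r) \<and> a = r \<otimes> (b \<otimes> b)" if "a \<in> carrier R" for a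
    using sq[OF that] num_closed num_fixed by blast
  ultimately show False
    using no_endo_of_order_4[OF two] by blast
qed

end


theorem theorem4p4:
  fixes K :: "('a, 'm) ring_scheme"
  assumes "field K"
    and "finitely_generated_field K \<or>
         real_closed_field K \<or>
         (\<exists>p. Factorial_Ring.prime p \<and> p_adically_closed_field p K) \<or>
         algebraically_closed K"
  shows "\<not> bi_interpretable (ring_structure K) (group_structure (heisenberg K))"
proof
  assume "bi_interpretable (ring_structure K) (group_structure (heisenberg K))"
  then interpret heisenberg_bi K
    using assms(1) by (simp add: heisenberg_bi_def heisenberg_bi_axioms_def)
  show False
    using assms(2) not_finitely_generated not_real_closed not_p_adically_closed
      not_algebraically_closed by blast
qed

end
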